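(* Let $(C,\Delta)$ be a coalgebra, with or without counit. A linear operator $P$ on $C$ is an idempotent Rota-Baxter operator of weight $-1$ if and only if there is a $\mathbb{K}$-vector space direct sum decomposition $C=C_1\oplus C_2$ of $C$ into noncounitary coideals $C_1$ and $C_2$ such that $P:C\to C_1$ is the projection of $C$ onto $C_1$, i.e. $P(c_1+c_2)=c_1$ for $c_1\in C_1$ and $c_2\in C_2$.
   Context: $\mathbb{K}$ is a fixed ground field of characteristic 0; all vector spaces, coalgebras and tensor products are over $\mathbb{K}$. The coproduct $\Delta$ is coassociative; a counit is not required. A Rota-Baxter operator of weight $\lambda\in\mathbb{K}$ on $(C,\Delta)$ is a linear map $P:C\to C$ such that $(P\otimes P)\Delta=(\mathrm{id}\otimes P)\Delta P+(P\otimes\mathrm{id})\Delta P+\lambda\Delta P$; it is idempotent if $P^2=P$. A noncounitary coideal of $C$ is a subspace $J$ with $\Delta(J)\subset C\otimes J+J\otimes C$. *)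

theory Defs
  imports "HOL-Algebra.Module" "HOL-Algebra.AbelCoset"
begin

section \<open>Linear algebra over a field\<close>

text \<open>
  A \<open>K\<close>-vector space is a module \<open>M\<close> with \<^term>\<open>module K M\<close>, where \<^term>\<open>field K\<close>.
  The fields \<open>mult\<close> and \<open>one\<close> of the record type of modules play no role, and are left
  unspecified below.
\<close>

definition linear_maps ::
    "('k, 'r) ring_scheme \<Rightarrow> ('k, 'a, 'm) module_scheme \<Rightarrow> ('k, 'b, 'n) module_scheme \<Rightarrow> ('a \<Rightarrow> 'b) set"
  where "linear_maps K M N =
    {h \<in> carrier M \<rightarrow> carrier N.
       (\<forall>x\<in>carrier M. \<forall>y\<in>carrier M. h (x \<oplus>\<^bsub>M\<^esub> y) = h x \<oplus>\<^bsub>N\<^esub> h y) \<and>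
       (\<forall>r\<in>carrier K. \<forall>x\<in>carrier M. h (r \<odot>\<^bsub>M\<^esub> x) = r \<odot>\<^bsub>N\<^esub> h x)}"

definition submodule_span ::
    "('k, 'r) ring_scheme \<Rightarrow> ('k, 'a, 'm) module_scheme \<Rightarrow> 'a set \<Rightarrow> 'a set"
  where "submodule_span K M S = \<Inter>{N. submodule N K M \<and> S \<subseteq> N}"

definition direct_sum_decomposition ::
    "('k, 'r) ring_scheme \<Rightarrow> ('k, 'a, 'm) module_scheme \<Rightarrow> 'a set \<Rightarrow> 'a set \<Rightarrow> bool"
  where "direct_sum_decomposition K M A B \<longleftrightarrow>
    submodule A K M \<and> submodule B K M \<and>
    A <+>\<^bsub>M\<^esub> B = carrier M \<and> A \<inter> B = {\<zero>\<^bsub>M\<^esub>}"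

definition quotient_module ::
    "('k, 'a, 'm) module_scheme \<Rightarrow> 'a set \<Rightarrow> ('k, 'a set) module"
  where "quotient_module M N =
    \<lparr>carrier = a_rcosets\<^bsub>M\<^esub> N, mult = undefined, one = undefined,
     zero = N, add = set_add M,
     smult = (\<lambda>r X. \<Union>x\<in>X. N +>\<^bsub>M\<^esub> (r \<odot>\<^bsub>M\<^esub> x))\<rparr>"

text \<open>The free module on \<open>X\<close>: finitely supported functions, extended by zero outside \<open>X\<close>.\<close>

definition free_module :: "('k, 'r) ring_scheme \<Rightarrow> 'x set \<Rightarrow> ('k, 'x \<Rightarrow> 'k) module"
  where "free_module K X =
    \<lparr>carrier = {f \<in> X \<rightarrow> carrier K. (\<forall>x. x \<notin> X \<longrightarrow> f x = \<zero>\<^bsub>K\<^esub>) \<and> finite {x. f x \<noteq> \<zero>\<^bsub>K\<^esub>}},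
     mult = undefined, one = undefined,
     zero = (\<lambda>x. \<zero>\<^bsub>K\<^esub>), add = (\<lambda>f g x. f x \<oplus>\<^bsub>K\<^esub> g x),
     smult = (\<lambda>r f x. r \<otimes>\<^bsub>K\<^esub> f x)\<rparr>"

definition free_gen :: "('k, 'r) ring_scheme \<Rightarrow> 'x \<Rightarrow> 'x \<Rightarrow> 'k"
  where "free_gen K x = (\<lambda>y. if y = x then \<one>\<^bsub>K\<^esub> else \<zero>\<^bsub>K\<^esub>)"


section \<open>Tensor products\<close>

definition tensor_relations ::
    "('k, 'r) ring_scheme \<Rightarrow> ('k, 'a, 'm) module_scheme \<Rightarrow> ('k, 'b, 'n) module_scheme \<Rightarrow> ('a \<times> 'b \<Rightarrow> 'k) set"
  where "tensor_relations K M N =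
    (let F = free_module K (carrier M \<times> carrier N) in
      {free_gen K (x \<oplus>\<^bsub>M\<^esub> x', y) \<ominus>\<^bsub>F\<^esub> (free_gen K (x, y) \<oplus>\<^bsub>F\<^esub> free_gen K (x', y)) | x x' y.
         x \<in> carrier M \<and> x' \<in> carrier M \<and> y \<in> carrier N} \<union>
      {free_gen K (x, y \<oplus>\<^bsub>N\<^esub> y') \<ominus>\<^bsub>F\<^esub> (free_gen K (x, y) \<oplus>\<^bsub>F\<^esub> free_gen K (x, y')) | x y y'.
         x \<in> carrier M \<and> y \<in> carrier N \<and> y' \<in> carrier N} \<union>
      {free_gen K (r \<odot>\<^bsub>M\<^esub> x, y) \<ominus>\<^bsub>F\<^esub> (r \<odot>\<^bsub>F\<^esub> free_gen K (x, y)) | r x y.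
         r \<in> carrier K \<and> x \<in> carrier M \<and> y \<in> carrier N} \<union>
      {free_gen K (x, r \<odot>\<^bsub>N\<^esub> y) \<ominus>\<^bsub>F\<^esub> (r \<odot>\<^bsub>F\<^esub> free_gen K (x, y)) | r x y.
         r \<in> carrier K \<and> x \<in> carrier M \<and> y \<in> carrier N})"

definition tensor_kernel ::
    "('k, 'r) ring_scheme \<Rightarrow> ('k, 'a, 'm) module_scheme \<Rightarrow> ('k, 'b, 'n) module_scheme \<Rightarrow> ('a \<times> 'b \<Rightarrow> 'k) set"
  where "tensor_kernel K M N =
    submodule_span K (free_module K (carrier M \<times> carrier N)) (tensor_relations K M N)"

definition tensor_product ::
    "('k, 'r) ring_scheme \<Rightarrow> ('k, 'a, 'm) module_scheme \<Rightarrow> ('k, 'b, 'n) module_scheme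
      \<Rightarrow> ('k, ('a \<times> 'b \<Rightarrow> 'k) set) module"
  where "tensor_product K M N =
    quotient_module (free_module K (carrier M \<times> carrier N)) (tensor_kernel K M N)"

definition pure_tensor ::
    "('k, 'r) ring_scheme \<Rightarrow> ('k, 'a, 'm) module_scheme \<Rightarrow> ('k, 'b, 'n) module_scheme
      \<Rightarrow> 'a \<Rightarrow> 'b \<Rightarrow> ('a \<times> 'b \<Rightarrow> 'k) set"
  where "pure_tensor K M N x y =
    tensor_kernel K M N +>\<^bsub>free_module K (carrier M \<times> carrier N)\<^esub> free_gen K (x, y)"

text \<open>
  For a bilinear map \<open>b\<close> from \<open>M\<close> and \<open>N\<close> to \<open>Q\<close>, the linear map \<open>M \<otimes> N \<rightarrow> Q\<close> that sends
  \<open>x \<otimes> y\<close> to \<open>b x y\<close>. Extensionality makes it unique as a HOL function.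
\<close>

definition tensor_lift ::
    "('k, 'r) ring_scheme \<Rightarrow> ('k, 'a, 'm) module_scheme \<Rightarrow> ('k, 'b, 'n) module_scheme
      \<Rightarrow> ('k, 'c, 'q) module_scheme \<Rightarrow> ('a \<Rightarrow> 'b \<Rightarrow> 'c) \<Rightarrow> ('a \<times> 'b \<Rightarrow> 'k) set \<Rightarrow> 'c"
  where "tensor_lift K M N Q b =
    (THE h. h \<in> linear_maps K (tensor_product K M N) Q \<and>
            h \<in> extensional (carrier (tensor_product K M N)) \<and>
            (\<forall>x\<in>carrier M. \<forall>y\<in>carrier N. h (pure_tensor K M N x y) = b x y))"

definition tensor_map ::
    "('k, 'r) ring_scheme \<Rightarrow> ('k, 'a, 'm) module_scheme \<Rightarrow> ('k, 'b, 'n) module_scheme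
      \<Rightarrow> ('k, 'c, 'p) module_scheme \<Rightarrow> ('k, 'd, 'q) module_scheme
      \<Rightarrow> ('a \<Rightarrow> 'c) \<Rightarrow> ('b \<Rightarrow> 'd) \<Rightarrow> ('a \<times> 'b \<Rightarrow> 'k) set \<Rightarrow> ('c \<times> 'd \<Rightarrow> 'k) set"
  where "tensor_map K M N M' N' f g =
    tensor_lift K M N (tensor_product K M' N') (\<lambda>x y. pure_tensor K M' N' (f x) (g y))"

text \<open>The associator \<open>(L \<otimes> M) \<otimes> N \<rightarrow> L \<otimes> (M \<otimes> N)\<close>, which sends \<open>(x \<otimes> y) \<otimes> z\<close> to \<open>x \<otimes> (y \<otimes> z)\<close>.\<close>

definition tensor_assoc ::
    "('k, 'r) ring_scheme \<Rightarrow> ('k, 'a, 'l) module_scheme \<Rightarrow> ('k, 'b, 'm) module_scheme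
      \<Rightarrow> ('k, 'c, 'n) module_scheme
      \<Rightarrow> (('a \<times> 'b \<Rightarrow> 'k) set \<times> 'c \<Rightarrow> 'k) set \<Rightarrow> ('a \<times> ('b \<times> 'c \<Rightarrow> 'k) set \<Rightarrow> 'k) set"
  where "tensor_assoc K L M N =
    tensor_lift K (tensor_product K L M) N (tensor_product K L (tensor_product K M N))
      (\<lambda>t z. tensor_lift K L M (tensor_product K L (tensor_product K M N))
        (\<lambda>x y. pure_tensor K L (tensor_product K M N) x (pure_tensor K M N y z)) t)"

text \<open>
  For subspaces \<open>A\<close> of \<open>M\<close> and \<open>B\<close> of \<open>N\<close>, the tensor product of \<open>A\<close> and \<open>B\<close> as a subspace
  of \<open>M \<otimes> N\<close>. Over a field the canonical map from \<open>A \<otimes> B\<close> to \<open>M \<otimes> N\<close> is injective, and this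
  is its image.
\<close>

definition tensor_subspace ::
    "('k, 'r) ring_scheme \<Rightarrow> ('k, 'a, 'm) module_scheme \<Rightarrow> ('k, 'b, 'n) module_scheme
      \<Rightarrow> 'a set \<Rightarrow> 'b set \<Rightarrow> ('a \<times> 'b \<Rightarrow> 'k) set set"
  where "tensor_subspace K M N A B =
    submodule_span K (tensor_product K M N) {pure_tensor K M N x y | x y. x \<in> A \<and> y \<in> B}"


section \<open>Coalgebras and Rota-Baxter operators\<close>

text \<open>No counit is required.\<close>

locale coalgebra = K: field K + C: module K C
  for K :: "('k, 'r) ring_scheme" and C :: "('k, 'c, 'm) module_scheme" +
  fixes \<Delta> :: "'c \<Rightarrow> ('c \<times> 'c \<Rightarrow> 'k) set"
  assumes coproduct_linear: "\<Delta> \<in> linear_maps K C (tensor_product K C C)"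
    and coassociative: "c \<in> carrier C \<Longrightarrow>
      tensor_assoc K C C C (tensor_map K C C (tensor_product K C C) C \<Delta> id (\<Delta> c))
        = tensor_map K C C C (tensor_product K C C) id \<Delta> (\<Delta> c)"

definition rota_baxter_operator ::
    "('k, 'r) ring_scheme \<Rightarrow> ('k, 'c, 'm) module_scheme \<Rightarrow> ('c \<Rightarrow> ('c \<times> 'c \<Rightarrow> 'k) set)
      \<Rightarrow> 'k \<Rightarrow> ('c \<Rightarrow> 'c) \<Rightarrow> bool"
  where "rota_baxter_operator K C \<Delta> w P \<longleftrightarrow>
    P \<in> linear_maps K C C \<and>
    (let T = tensor_product K C C; tmap = tensor_map K C C C C in
      \<forall>c\<in>carrier C.
        tmap P P (\<Delta> c) =
          tmap id P (\<Delta> (P c)) \<oplus>\<^bsub>T\<^esub> tmap P id (\<Delta> (P c)) \<oplus>\<^bsub>T\<^esub> w \<odot>\<^bsub>T\<^esub> \<Delta> (P c))"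

definition noncounitary_coideal ::
    "('k, 'r) ring_scheme \<Rightarrow> ('k, 'c, 'm) module_scheme \<Rightarrow> ('c \<Rightarrow> ('c \<times> 'c \<Rightarrow> 'k) set)
      \<Rightarrow> 'c set \<Rightarrow> bool"
  where "noncounitary_coideal K C \<Delta> J \<longleftrightarrow>
    submodule J K C \<and>
    \<Delta> ` J \<subseteq> tensor_subspace K C C (carrier C) J
              <+>\<^bsub>tensor_product K C C\<^esub> tensor_subspace K C C J (carrier C)"


section \<open>The universal property of the tensor product\<close>

text \<open>The last theorem below justifies the definite description in \<open>tensor_lift\<close>.\<close>

lemma submodule_span_submodule:
  assumes "module K M" "S \<subseteq> carrier M"
  shows "submodule (submodule_span K M S) K M"
proof -
  interpret module K M by fact
  have c: "submodule (carrier M) K M" by (rule carrier_is_submodule)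
  show ?thesis
  proof (rule submoduleI)
    show "submodule_span K M S \<subseteq> carrier M" using c assms(2) unfolding submodule_span_def by auto
    show "\<zero>\<^bsub>M\<^esub> \<in> submodule_span K M S" unfolding submodule_span_def
      by (auto simp: submodule_def dest!: subgroup.one_closed)
  next
    fix a assume "a \<in> submodule_span K M S" then show "\<ominus>\<^bsub>M\<^esub> a \<in> submodule_span K M S"
      unfolding submodule_span_def using submoduleE(3) by blast
  next
    fix a b assume "a \<in> submodule_span K M S" "b \<in> submodule_span K M S" then show "a \<oplus>\<^bsub>M\<^esub> b \<in> submodule_span K M S"
      unfolding submodule_span_def using submoduleE(5) by blast
  next
    fix a x assume "a \<in> carrier K" "x \<in> submodule_span K M S" then show "a \<odot>\<^bsub>M\<^esub> x \<in> submodule_span K M S"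
      unfolding submodule_span_def using submoduleE(4) by blast
  qed
qed

lemma submodule_span_induct:
  assumes "x \<in> submodule_span K M S" "submodule N K M" "S \<subseteq> N"
  shows "x \<in> N" using assms unfolding submodule_span_def by auto

lemma free_module_module:
  assumes "cring K" shows "module K (free_module K X)"
proof -
  interpret cring K by fact
  let ?F = "free_module K X"
  have fin_add: "finite {x. f x \<oplus>\<^bsub>K\<^esub> g x \<noteq> \<zero>\<^bsub>K\<^esub>}" if "f \<in> carrier ?F" "g \<in> carrier ?F" for f g
    by (rule finite_subset[of _ "{x. f x \<noteq> \<zero>\<^bsub>K\<^esub>} \<union> {x. g x \<noteq> \<zero>\<^bsub>K\<^esub>}"]) (use that in \<open>auto simp: free_module_def\<close>)
  have in_car: "f x \<in> carrier K" if "f \<in> carrier ?F" for f x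
    using that by (cases "x \<in> X") (auto simp: free_module_def)
  have add: "(f \<oplus>\<^bsub>?F\<^esub> g) = (\<lambda>x. f x \<oplus>\<^bsub>K\<^esub> g x)" for f g by (simp add: free_module_def)
  have sm: "(r \<odot>\<^bsub>?F\<^esub> g) = (\<lambda>x. r \<otimes>\<^bsub>K\<^esub> g x)" for r g by (simp add: free_module_def)
  have fin_sm: "finite {x. r \<otimes>\<^bsub>K\<^esub> g x \<noteq> \<zero>\<^bsub>K\<^esub>}" if "r \<in> carrier K" "g \<in> carrier ?F" for r g
    by (rule finite_subset[of _ "{x. g x \<noteq> \<zero>\<^bsub>K\<^esub>}"]) (use that in \<open>auto simp: free_module_def\<close>)
  show ?thesis
  proof (rule moduleI)
    show "cring K" by fact
    show "abelian_group ?F"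
    proof (rule abelian_groupI)
      fix x y assume "x \<in> carrier ?F" "y \<in> carrier ?F"
      then show "x \<oplus>\<^bsub>?F\<^esub> y \<in> carrier ?F" using fin_add[of x y] by (auto simp: free_module_def)
    next
      show "\<zero>\<^bsub>?F\<^esub> \<in> carrier ?F" by (auto simp: free_module_def)
    next
      fix x y z assume "x \<in> carrier ?F" "y \<in> carrier ?F" "z \<in> carrier ?F"
      then show "x \<oplus>\<^bsub>?F\<^esub> y \<oplus>\<^bsub>?F\<^esub> z = x \<oplus>\<^bsub>?F\<^esub> (y \<oplus>\<^bsub>?F\<^esub> z)" by (auto simp: add in_car a_assoc fun_eq_iff)
    next
      fix x y assume "x \<in> carrier ?F" "y \<in> carrier ?F"
      then show "x \<oplus>\<^bsub>?F\<^esub> y = y \<oplus>\<^bsub>?F\<^esub> x" by (auto simp: add in_car a_comm fun_eq_iff)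
    next
      fix x assume x: "x \<in> carrier ?F"
      then show "\<zero>\<^bsub>?F\<^esub> \<oplus>\<^bsub>?F\<^esub> x = x" using in_car[OF x] by (auto simp: free_module_def)
      show "\<exists>y\<in>carrier ?F. y \<oplus>\<^bsub>?F\<^esub> x = \<zero>\<^bsub>?F\<^esub>"
      proof (rule bexI)
        show "(\<lambda>z. \<ominus>\<^bsub>K\<^esub> x z) \<oplus>\<^bsub>?F\<^esub> x = \<zero>\<^bsub>?F\<^esub>" using in_car[OF x] by (auto simp: free_module_def l_neg)
        have "finite {z. \<ominus>\<^bsub>K\<^esub> x z \<noteq> \<zero>\<^bsub>K\<^esub>}"
          by (rule finite_subset[of _ "{z. x z \<noteq> \<zero>\<^bsub>K\<^esub>}"]) (use x in \<open>auto simp: free_module_def\<close>)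
        then show "(\<lambda>z. \<ominus>\<^bsub>K\<^esub> x z) \<in> carrier ?F" using x in_car[OF x] by (auto simp: free_module_def)
      qed
    qed
    show "a \<odot>\<^bsub>?F\<^esub> x \<in> carrier ?F" if "a \<in> carrier K" "x \<in> carrier ?F" for a x
      using that fin_sm[OF that] by (auto simp: free_module_def)
    show "(a \<oplus>\<^bsub>K\<^esub> b) \<odot>\<^bsub>?F\<^esub> x = (a \<odot>\<^bsub>?F\<^esub> x) \<oplus>\<^bsub>?F\<^esub> (b \<odot>\<^bsub>?F\<^esub> x)" if "a \<in> carrier K" "b \<in> carrier K" "x \<in> carrier ?F" for a b x
      using that by (auto simp: add sm in_car l_distr)
    show "a \<odot>\<^bsub>?F\<^esub> (x \<oplus>\<^bsub>?F\<^esub> y) = (a \<odot>\<^bsub>?F\<^esub> x) \<oplus>\<^bsub>?F\<^esub> (a \<odot>\<^bsub>?F\<^esub> y)" if "a \<in> carrier K" "x \<in> carrier ?F" "y \<in> carrier ?F" for a x y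
      using that by (auto simp: add sm in_car r_distr)
    show "(a \<otimes>\<^bsub>K\<^esub> b) \<odot>\<^bsub>?F\<^esub> x = a \<odot>\<^bsub>?F\<^esub> (b \<odot>\<^bsub>?F\<^esub> x)" if "a \<in> carrier K" "b \<in> carrier K" "x \<in> carrier ?F" for a b x
      using that by (auto simp: sm in_car m_assoc)
    show "\<one>\<^bsub>K\<^esub> \<odot>\<^bsub>?F\<^esub> x = x" if "x \<in> carrier ?F" for x
      using that by (auto simp: sm in_car)
  qed
qed

lemma quotient_facts:
  assumes "module K M" "submodule N K M"
  shows quotient_module_module: "module K (quotient_module M N)"
    and quotient_proj: "(\<lambda>x. N +>\<^bsub>M\<^esub> x) \<in> linear_maps K M (quotient_module M N)"
    and quotient_surj: "carrier (quotient_module M N) = (\<lambda>x. N +>\<^bsub>M\<^esub> x) ` carrier M"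
    and quotient_eq: "\<And>x y. x \<in> carrier M \<Longrightarrow> y \<in> carrier M \<Longrightarrow> (N +>\<^bsub>M\<^esub> x = N +>\<^bsub>M\<^esub> y) \<longleftrightarrow> x \<ominus>\<^bsub>M\<^esub> y \<in> N"
proof -
  interpret module K M by fact
  interpret S: submodule N K M by fact
  interpret A: abelian_subgroup N M
    by (rule abelian_subgroupI3) (auto simp: additive_subgroup_def S.subgroup_axioms abelian_group_axioms)
  let ?Q = "quotient_module M N" and ?p = "\<lambda>x. N +>\<^bsub>M\<^esub> x"
  show car: "carrier ?Q = ?p ` carrier M"
    by (auto simp: quotient_module_def A_RCOSETS_def RCOSETS_def a_r_coset_def)
  have N: "N \<subseteq> carrier M" using S.subset by simp
  show eq: "(?p x = ?p y) \<longleftrightarrow> x \<ominus>\<^bsub>M\<^esub> y \<in> N" if "x \<in> carrier M" "y \<in> carrier M" for x y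
  proof
    assume "?p x = ?p y" then have "x \<in> ?p y" using A.a_rcos_self[OF that(1)] by simp
    then show "x \<ominus>\<^bsub>M\<^esub> y \<in> N" using A.a_rcos_module that by (simp add: a_minus_def)
  next
    assume "x \<ominus>\<^bsub>M\<^esub> y \<in> N"
    then have "x \<in> ?p y" using A.a_rcos_module that by (simp add: a_minus_def)
    then show "?p x = ?p y" using a_repr_independence[OF _ that(2)] S.subgroup_axioms by (metis)
  qed
  have add: "?p x \<oplus>\<^bsub>?Q\<^esub> ?p y = ?p (x \<oplus>\<^bsub>M\<^esub> y)" if "x \<in> carrier M" "y \<in> carrier M" for x y
    using A.a_rcos_sum[OF that] by (simp add: quotient_module_def)
  have zero: "\<zero>\<^bsub>?Q\<^esub> = ?p \<zero>\<^bsub>M\<^esub>" using a_coset_add_zero[OF N] by (simp add: quotient_module_def)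
  have sm: "r \<odot>\<^bsub>?Q\<^esub> ?p x = ?p (r \<odot>\<^bsub>M\<^esub> x)" if "r \<in> carrier K" "x \<in> carrier M" for r x
  proof -
    have "?p (r \<odot>\<^bsub>M\<^esub> y) = ?p (r \<odot>\<^bsub>M\<^esub> x)" if y: "y \<in> ?p x" for y
    proof -
      have yc: "y \<in> carrier M" using y a_r_coset_subset_G[OF N \<open>x \<in> carrier M\<close>] by auto
      have "y \<ominus>\<^bsub>M\<^esub> x \<in> N" using y A.a_rcos_module yc \<open>x \<in> carrier M\<close> by (simp add: a_minus_def)
      then have "r \<odot>\<^bsub>M\<^esub> (y \<ominus>\<^bsub>M\<^esub> x) \<in> N" using \<open>r \<in> carrier K\<close> by simp
      also have "r \<odot>\<^bsub>M\<^esub> (y \<ominus>\<^bsub>M\<^esub> x) = r \<odot>\<^bsub>M\<^esub> y \<ominus>\<^bsub>M\<^esub> r \<odot>\<^bsub>M\<^esub> x"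
        using \<open>r \<in> carrier K\<close> \<open>x \<in> carrier M\<close> yc by (simp add: a_minus_def smult_r_distr smult_r_minus)
      finally show ?thesis using eq \<open>r \<in> carrier K\<close> \<open>x \<in> carrier M\<close> yc by simp
    qed
    moreover have "x \<in> ?p x" using A.a_rcos_self[OF that(2)] .
    ultimately have "(\<Union>y\<in>?p x. ?p (r \<odot>\<^bsub>M\<^esub> y)) = ?p (r \<odot>\<^bsub>M\<^esub> x)" by blast
    then show ?thesis by (simp add: quotient_module_def)
  qed
  show "?p \<in> linear_maps K M ?Q"
    using car add sm by (auto simp: linear_maps_def)
  have ex: "\<exists>x\<in>carrier M. X = ?p x" if "X \<in> carrier ?Q" for X using that car by auto
  have pc: "?p x \<in> carrier ?Q" if "x \<in> carrier M" for x using that car by auto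
  note s = add sm zero a_assoc smult_l_distr smult_r_distr smult_assoc1
  show "module K ?Q"
  proof (rule moduleI)
    show "cring K" by (rule R.is_cring)
    show "abelian_group ?Q"
    proof (rule abelian_groupI)
      fix X Y Z assume "X \<in> carrier ?Q" "Y \<in> carrier ?Q" "Z \<in> carrier ?Q"
      then obtain x y z where "x \<in> carrier M" "y \<in> carrier M" "z \<in> carrier M" "X = ?p x" "Y = ?p y" "Z = ?p z" using ex by meson
      then show "X \<oplus>\<^bsub>?Q\<^esub> Y \<oplus>\<^bsub>?Q\<^esub> Z = X \<oplus>\<^bsub>?Q\<^esub> (Y \<oplus>\<^bsub>?Q\<^esub> Z)" by (simp add: s)
    next
      fix X Y assume "X \<in> carrier ?Q" "Y \<in> carrier ?Q"
      then obtain x y where xy: "x \<in> carrier M" "y \<in> carrier M" "X = ?p x" "Y = ?p y" using ex by meson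
      then show "X \<oplus>\<^bsub>?Q\<^esub> Y = Y \<oplus>\<^bsub>?Q\<^esub> X" by (simp add: add M.a_comm[OF xy(1,2)])
      show "X \<oplus>\<^bsub>?Q\<^esub> Y \<in> carrier ?Q" using xy by (simp add: s pc)
    next
      show "\<zero>\<^bsub>?Q\<^esub> \<in> carrier ?Q" by (simp add: zero pc)
    next
      fix X assume "X \<in> carrier ?Q"
      then obtain x where x: "x \<in> carrier M" "X = ?p x" using ex by meson
      then show "\<zero>\<^bsub>?Q\<^esub> \<oplus>\<^bsub>?Q\<^esub> X = X" by (simp add: s)
      show "\<exists>Y\<in>carrier ?Q. Y \<oplus>\<^bsub>?Q\<^esub> X = \<zero>\<^bsub>?Q\<^esub>"
        by (rule bexI[of _ "?p (\<ominus>\<^bsub>M\<^esub> x)"]) (use x in \<open>simp_all add: s pc M.l_neg\<close>)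
    qed
  next
    fix a X assume a: "a \<in> carrier K" and "X \<in> carrier ?Q"
    then obtain x where x: "x \<in> carrier M" "X = ?p x" using ex by meson
    show "a \<odot>\<^bsub>?Q\<^esub> X \<in> carrier ?Q" using a x by (simp add: s pc)
    fix Y assume "Y \<in> carrier ?Q"
    then obtain y where "y \<in> carrier M" "Y = ?p y" using ex by meson
    then show "a \<odot>\<^bsub>?Q\<^esub> (X \<oplus>\<^bsub>?Q\<^esub> Y) = (a \<odot>\<^bsub>?Q\<^esub> X) \<oplus>\<^bsub>?Q\<^esub> (a \<odot>\<^bsub>?Q\<^esub> Y)" using a x by (simp add: s)
  next
    fix a b X assume a: "a \<in> carrier K" "b \<in> carrier K" and "X \<in> carrier ?Q"
    then obtain x where x: "x \<in> carrier M" "X = ?p x" using ex by meson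
    show "(a \<oplus>\<^bsub>K\<^esub> b) \<odot>\<^bsub>?Q\<^esub> X = (a \<odot>\<^bsub>?Q\<^esub> X) \<oplus>\<^bsub>?Q\<^esub> (b \<odot>\<^bsub>?Q\<^esub> X)" using a x by (simp add: s)
    show "(a \<otimes>\<^bsub>K\<^esub> b) \<odot>\<^bsub>?Q\<^esub> X = a \<odot>\<^bsub>?Q\<^esub> (b \<odot>\<^bsub>?Q\<^esub> X)" using a x by (simp add: s)
  next
    fix X assume "X \<in> carrier ?Q"
    then obtain x where x: "x \<in> carrier M" "X = ?p x" using ex by meson
    show "\<one>\<^bsub>K\<^esub> \<odot>\<^bsub>?Q\<^esub> X = X" using x by (simp add: s)
  qed
qed

lemma free_gen_in: assumes "cring K" "x \<in> X" shows "free_gen K x \<in> carrier (free_module K X)"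
proof -
  interpret cring K by fact
  have "finite {y. free_gen K x y \<noteq> \<zero>\<^bsub>K\<^esub>}"
    by (rule finite_subset[of _ "{x}"]) (auto simp: free_gen_def)
  then show ?thesis using assms(2) by (auto simp: free_module_def free_gen_def)
qed

lemma free_lift:
  assumes "module K Q" "f \<in> X \<rightarrow> carrier Q"
  defines "h \<equiv> \<lambda>\<phi>. \<Oplus>\<^bsub>Q\<^esub>x\<in>{x. \<phi> x \<noteq> \<zero>\<^bsub>K\<^esub>}. \<phi> x \<odot>\<^bsub>Q\<^esub> f x"
  shows "h \<in> linear_maps K (free_module K X) Q" "\<And>x. x \<in> X \<Longrightarrow> \<one>\<^bsub>K\<^esub> \<noteq> \<zero>\<^bsub>K\<^esub> \<Longrightarrow> h (free_gen K x) = f x"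
proof -
  interpret module K Q by fact
  let ?F = "free_module K X"
  have in_car: "\<phi> x \<in> carrier K" if "\<phi> \<in> carrier ?F" for \<phi> x
    using that by (cases "x \<in> X") (auto simp: free_module_def)
  have ext: "h \<phi> = (\<Oplus>\<^bsub>Q\<^esub>x\<in>A. \<phi> x \<odot>\<^bsub>Q\<^esub> f x)"
    if "\<phi> \<in> carrier ?F" "finite A" "A \<subseteq> X" "{x. \<phi> x \<noteq> \<zero>\<^bsub>K\<^esub>} \<subseteq> A" for \<phi> A
    unfolding h_def
    by (rule M.add.finprod_mono_neutral_cong_left[OF that(2) that(4), folded finsum_def])
       (use that assms(2) in_car in \<open>auto simp: Pi_iff\<close>)
  have sub: "{x. \<phi> x \<noteq> \<zero>\<^bsub>K\<^esub>} \<subseteq> X" "finite {x. \<phi> x \<noteq> \<zero>\<^bsub>K\<^esub>}" if "\<phi> \<in> carrier ?F" for \<phi>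
    using that by (auto simp: free_module_def)
  interpret F: module K ?F by (rule free_module_module) (rule R.is_cring)
  show "h \<in> linear_maps K ?F Q"
    unfolding linear_maps_def
  proof (intro CollectI conjI ballI)
    show "h \<in> carrier ?F \<rightarrow> carrier Q"
    proof
      fix p assume p: "p \<in> carrier ?F"
      show "h p \<in> carrier Q" unfolding h_def using sub[OF p] in_car[OF p] assms(2)
        by (intro M.finsum_closed) auto
    qed
  next
    fix p q assume pq: "p \<in> carrier ?F" "q \<in> carrier ?F"
    let ?A = "{x. p x \<noteq> \<zero>\<^bsub>K\<^esub>} \<union> {x. q x \<noteq> \<zero>\<^bsub>K\<^esub>}"
    have A: "finite ?A" "?A \<subseteq> X" using sub pq by auto
    have pqc: "p \<oplus>\<^bsub>?F\<^esub> q \<in> carrier ?F" using pq by simp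
    have eq: "p \<oplus>\<^bsub>?F\<^esub> q = (\<lambda>x. p x \<oplus>\<^bsub>K\<^esub> q x)" by (simp add: free_module_def)
    have "h (p \<oplus>\<^bsub>?F\<^esub> q) = (\<Oplus>\<^bsub>Q\<^esub>x\<in>?A. (p x \<oplus>\<^bsub>K\<^esub> q x) \<odot>\<^bsub>Q\<^esub> f x)"
    proof -
      have "{x. (p \<oplus>\<^bsub>?F\<^esub> q) x \<noteq> \<zero>\<^bsub>K\<^esub>} \<subseteq> ?A" by (auto simp: eq)
      from ext[OF pqc A this] show ?thesis by (simp add: eq)
    qed
    also have "\<dots> = (\<Oplus>\<^bsub>Q\<^esub>x\<in>?A. p x \<odot>\<^bsub>Q\<^esub> f x \<oplus>\<^bsub>Q\<^esub> q x \<odot>\<^bsub>Q\<^esub> f x)"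
    proof (rule M.finsum_cong')
      show "(\<lambda>x. p x \<odot>\<^bsub>Q\<^esub> f x \<oplus>\<^bsub>Q\<^esub> q x \<odot>\<^bsub>Q\<^esub> f x) \<in> ?A \<rightarrow> carrier Q"
        using A(2) assms(2) in_car pq by blast
    next
      fix i assume "i \<in> ?A" then have "f i \<in> carrier Q" using A(2) assms(2) by blast
      then show "(p i \<oplus>\<^bsub>K\<^esub> q i) \<odot>\<^bsub>Q\<^esub> f i = p i \<odot>\<^bsub>Q\<^esub> f i \<oplus>\<^bsub>Q\<^esub> q i \<odot>\<^bsub>Q\<^esub> f i"
        using in_car pq by (simp add: smult_l_distr)
    qed simp
    also have "\<dots> = (\<Oplus>\<^bsub>Q\<^esub>x\<in>?A. p x \<odot>\<^bsub>Q\<^esub> f x) \<oplus>\<^bsub>Q\<^esub> (\<Oplus>\<^bsub>Q\<^esub>x\<in>?A. q x \<odot>\<^bsub>Q\<^esub> f x)"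
      by (rule M.finsum_addf) (use A(2) assms(2) in_car pq in blast)+
    also have "\<dots> = h p \<oplus>\<^bsub>Q\<^esub> h q" using ext[OF pq(1) A] ext[OF pq(2) A] by simp
    finally show "h (p \<oplus>\<^bsub>?F\<^esub> q) = h p \<oplus>\<^bsub>Q\<^esub> h q" .
  next
    fix r p assume r: "r \<in> carrier K" and p: "p \<in> carrier ?F"
    let ?A = "{x. p x \<noteq> \<zero>\<^bsub>K\<^esub>}"
    have rp: "r \<odot>\<^bsub>?F\<^esub> p \<in> carrier ?F" using r p by simp
    have eq: "r \<odot>\<^bsub>?F\<^esub> p = (\<lambda>x. r \<otimes>\<^bsub>K\<^esub> p x)" by (simp add: free_module_def)
    have "h (r \<odot>\<^bsub>?F\<^esub> p) = (\<Oplus>\<^bsub>Q\<^esub>x\<in>?A. (r \<otimes>\<^bsub>K\<^esub> p x) \<odot>\<^bsub>Q\<^esub> f x)"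
    proof -
      have "{x. (r \<odot>\<^bsub>?F\<^esub> p) x \<noteq> \<zero>\<^bsub>K\<^esub>} \<subseteq> ?A" using r by (auto simp: eq)
      from ext[OF rp sub(2)[OF p] sub(1)[OF p] this] show ?thesis by (simp add: eq)
    qed
    also have "\<dots> = (\<Oplus>\<^bsub>Q\<^esub>x\<in>?A. r \<odot>\<^bsub>Q\<^esub> (p x \<odot>\<^bsub>Q\<^esub> f x))"
    proof (rule M.finsum_cong')
      show "(\<lambda>x. r \<odot>\<^bsub>Q\<^esub> (p x \<odot>\<^bsub>Q\<^esub> f x)) \<in> ?A \<rightarrow> carrier Q"
        using sub(1)[OF p] assms(2) in_car p r by blast
    next
      fix i assume "i \<in> ?A" then have "f i \<in> carrier Q" using sub(1)[OF p] assms(2) by blast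
      then show "(r \<otimes>\<^bsub>K\<^esub> p i) \<odot>\<^bsub>Q\<^esub> f i = r \<odot>\<^bsub>Q\<^esub> (p i \<odot>\<^bsub>Q\<^esub> f i)"
        using in_car p r by (simp add: smult_assoc1)
    qed simp
    also have "\<dots> = r \<odot>\<^bsub>Q\<^esub> h p" unfolding h_def
      by (rule finsum_smult_ldistr[symmetric, OF sub(2)[OF p] r]) (use sub(1)[OF p] assms(2) in_car p in blast)
    finally show "h (r \<odot>\<^bsub>?F\<^esub> p) = r \<odot>\<^bsub>Q\<^esub> h p" .
  qed
  fix x assume x: "x \<in> X" and ne: "\<one>\<^bsub>K\<^esub> \<noteq> \<zero>\<^bsub>K\<^esub>"
  have g: "free_gen K x \<in> carrier ?F" using x R.is_cring by (rule_tac free_gen_in)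
  have "f x \<in> carrier Q" using x assms(2) by auto
  then have "(\<Oplus>\<^bsub>Q\<^esub>y\<in>{x}. free_gen K x y \<odot>\<^bsub>Q\<^esub> f y) = f x"
    by (simp add: free_gen_def)
  moreover have "{y. free_gen K x y \<noteq> \<zero>\<^bsub>K\<^esub>} \<subseteq> {x}" by (auto simp: free_gen_def)
  ultimately show "h (free_gen K x) = f x"
    using ext[OF g, of "{x}"] x by simp
qed

lemma linear_zero_minus:
  assumes "module K M" "module K N" "h \<in> linear_maps K M N"
  shows "h \<zero>\<^bsub>M\<^esub> = \<zero>\<^bsub>N\<^esub>" "\<And>x. x \<in> carrier M \<Longrightarrow> h (\<ominus>\<^bsub>M\<^esub> x) = \<ominus>\<^bsub>N\<^esub> h x"
    "\<And>x y. x \<in> carrier M \<Longrightarrow> y \<in> carrier M \<Longrightarrow> h (x \<ominus>\<^bsub>M\<^esub> y) = h x \<ominus>\<^bsub>N\<^esub> h y"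
proof -
  interpret M: module K M by fact
  interpret N: module K N by fact
  have c: "h x \<in> carrier N" if "x \<in> carrier M" for x using assms(3) that by (auto simp: linear_maps_def)
  have a: "h (x \<oplus>\<^bsub>M\<^esub> y) = h x \<oplus>\<^bsub>N\<^esub> h y" if "x \<in> carrier M" "y \<in> carrier M" for x y
    using assms(3) that by (auto simp: linear_maps_def)
  show z: "h \<zero>\<^bsub>M\<^esub> = \<zero>\<^bsub>N\<^esub>" using a[of "\<zero>\<^bsub>M\<^esub>" "\<zero>\<^bsub>M\<^esub>"] c[of "\<zero>\<^bsub>M\<^esub>"]
    by (metis M.M.zero_closed M.M.l_zero N.M.add.r_cancel_one')
  show m: "h (\<ominus>\<^bsub>M\<^esub> x) = \<ominus>\<^bsub>N\<^esub> h x" if "x \<in> carrier M" for x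
    using a[of "\<ominus>\<^bsub>M\<^esub> x" x] c that z by (simp add: M.M.l_neg N.M.minus_equality)
  show "h (x \<ominus>\<^bsub>M\<^esub> y) = h x \<ominus>\<^bsub>N\<^esub> h y" if "x \<in> carrier M" "y \<in> carrier M" for x y
    using that a m by (simp add: a_minus_def)
qed

lemma tensor_relations_in:
  assumes "module K M" "module K N"
  shows "tensor_relations K M N \<subseteq> carrier (free_module K (carrier M \<times> carrier N))"
proof -
  interpret M: module K M by fact
  interpret N: module K N by fact
  let ?F = "free_module K (carrier M \<times> carrier N)"
  interpret F: module K ?F by (rule free_module_module) (rule M.R.is_cring)
  have g: "free_gen K (x,y) \<in> carrier ?F" if "x \<in> carrier M" "y \<in> carrier N" for x y
    using that M.R.is_cring by (auto intro!: free_gen_in)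
  show ?thesis unfolding tensor_relations_def Let_def using g by auto
qed

lemma free_span:
  assumes "cring K" "submodule N K (free_module K X)" "\<And>x. x \<in> X \<Longrightarrow> free_gen K x \<in> N"
  shows "carrier (free_module K X) \<subseteq> N"
proof
  interpret cring K by fact
  let ?F = "free_module K X"
  interpret F: module K ?F by (rule free_module_module) fact
  fix p assume "p \<in> carrier ?F"
  then have "finite {x. p x \<noteq> \<zero>\<^bsub>K\<^esub>}" by (simp add: free_module_def)
  from this \<open>p \<in> carrier ?F\<close> show "p \<in> N"
  proof (induction "{x. p x \<noteq> \<zero>\<^bsub>K\<^esub>}" arbitrary: p rule: finite_induct)
    case empty
    then have "p = \<zero>\<^bsub>?F\<^esub>" by (auto simp: free_module_def)
    then show ?case using assms(2) by (auto simp: submodule_def dest: subgroup.one_closed)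
  next
    case (insert x A)
    define q where "q = p(x := \<zero>\<^bsub>K\<^esub>)"
    have A: "A = {x. q x \<noteq> \<zero>\<^bsub>K\<^esub>}" using insert.hyps(2,4) by (auto simp: q_def)
    have c: "p y \<in> carrier K" for y using insert.prems by (cases "y \<in> X") (auto simp: free_module_def)
    have q: "q \<in> carrier ?F" using insert.prems insert.hyps(1) A c by (auto simp: free_module_def q_def)
    have x: "x \<in> X" using insert.prems insert.hyps(4) by (auto simp: free_module_def)
    have "p = q \<oplus>\<^bsub>?F\<^esub> (p x \<odot>\<^bsub>?F\<^esub> free_gen K x)"
      using c by (auto simp: free_module_def q_def free_gen_def)
    then show ?case using insert.hyps(3)[OF A q] assms(3)[OF x] c F.submoduleE(4,5)[OF assms(2)]
      by metis
  qed
qed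

theorem tensor_universal:
  assumes "field K" "module K M" "module K N" "module K Q"
    and bc: "\<And>x y. x \<in> carrier M \<Longrightarrow> y \<in> carrier N \<Longrightarrow> b x y \<in> carrier Q"
    and b1: "\<And>x x' y. x \<in> carrier M \<Longrightarrow> x' \<in> carrier M \<Longrightarrow> y \<in> carrier N \<Longrightarrow> b (x \<oplus>\<^bsub>M\<^esub> x') y = b x y \<oplus>\<^bsub>Q\<^esub> b x' y"
    and b2: "\<And>x y y'. x \<in> carrier M \<Longrightarrow> y \<in> carrier N \<Longrightarrow> y' \<in> carrier N \<Longrightarrow> b x (y \<oplus>\<^bsub>N\<^esub> y') = b x y \<oplus>\<^bsub>Q\<^esub> b x y'"
    and b3: "\<And>r x y. r \<in> carrier K \<Longrightarrow> x \<in> carrier M \<Longrightarrow> y \<in> carrier N \<Longrightarrow> b (r \<odot>\<^bsub>M\<^esub> x) y = r \<odot>\<^bsub>Q\<^esub> b x y"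
    and b4: "\<And>r x y. r \<in> carrier K \<Longrightarrow> x \<in> carrier M \<Longrightarrow> y \<in> carrier N \<Longrightarrow> b x (r \<odot>\<^bsub>N\<^esub> y) = r \<odot>\<^bsub>Q\<^esub> b x y"
  shows "\<exists>!h. h \<in> linear_maps K (tensor_product K M N) Q \<and>
            h \<in> extensional (carrier (tensor_product K M N)) \<and>
            (\<forall>x\<in>carrier M. \<forall>y\<in>carrier N. h (pure_tensor K M N x y) = b x y)" (is "\<exists>!h. ?P h")
proof -
  interpret field K by fact
  interpret M: module K M by fact
  interpret N: module K N by fact
  interpret Q: module K Q by fact
  let ?X = "carrier M \<times> carrier N"
  let ?F = "free_module K ?X"
  let ?N = "tensor_kernel K M N" and ?T = "tensor_product K M N"
  interpret F: module K ?F by (rule free_module_module) (rule is_cring)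
  have sub: "submodule ?N K ?F" unfolding tensor_kernel_def
    by (rule submodule_span_submodule[OF F.module_axioms tensor_relations_in[OF assms(2,3)]])
  have g: "free_gen K (x,y) \<in> carrier ?F" if "x \<in> carrier M" "y \<in> carrier N" for x y
    using that is_cring by (auto intro!: free_gen_in)
  note qf = quotient_facts[OF F.module_axioms sub, folded tensor_product_def]
  interpret T: module K ?T by (rule qf(1))
  let ?p = "\<lambda>x. ?N +>\<^bsub>?F\<^esub> x"
  obtain h where h: "h \<in> linear_maps K ?F Q" and hg: "\<And>x y. x \<in> carrier M \<Longrightarrow> y \<in> carrier N \<Longrightarrow> h (free_gen K (x,y)) = b x y"
    using free_lift[OF assms(4), of "\<lambda>(x,y). b x y" ?X] bc by fastforce
  note hz = linear_zero_minus[OF F.module_axioms assms(4) h]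
  have hc: "h x \<in> carrier Q" if "x \<in> carrier ?F" for x using h that by (auto simp: linear_maps_def)
  have ha: "h (x \<oplus>\<^bsub>?F\<^esub> y) = h x \<oplus>\<^bsub>Q\<^esub> h y" if "x \<in> carrier ?F" "y \<in> carrier ?F" for x y
    using h that by (auto simp: linear_maps_def)
  have hs: "h (r \<odot>\<^bsub>?F\<^esub> x) = r \<odot>\<^bsub>Q\<^esub> h x" if "r \<in> carrier K" "x \<in> carrier ?F" for r x
    using h that by (auto simp: linear_maps_def)
  have ker: "submodule {x \<in> carrier ?F. h x = \<zero>\<^bsub>Q\<^esub>} K ?F"
    by (rule F.submoduleI) (auto simp: hz ha hs)
  have rel0: "tensor_relations K M N \<subseteq> {x \<in> carrier ?F. h x = \<zero>\<^bsub>Q\<^esub>}"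
  proof -
    have "u \<ominus>\<^bsub>Q\<^esub> u = \<zero>\<^bsub>Q\<^esub>" if "u \<in> carrier Q" for u using that by (simp add: a_minus_def Q.M.r_neg)
    then show ?thesis
      unfolding tensor_relations_def Let_def
      by (auto simp: hz ha hs hg g b1 b2 b3 b4 bc)
  qed
  have van: "h x = \<zero>\<^bsub>Q\<^esub>" if "x \<in> ?N" for x
    using submodule_span_induct[OF that[unfolded tensor_kernel_def] ker rel0] by simp
  have wd: "h x = h y" if "x \<in> carrier ?F" "y \<in> carrier ?F" "?p x = ?p y" for x y
  proof -
    have "h (x \<ominus>\<^bsub>?F\<^esub> y) = \<zero>\<^bsub>Q\<^esub>" using van qf(4) that by blast
    then have "h x \<oplus>\<^bsub>Q\<^esub> (\<ominus>\<^bsub>Q\<^esub> h y) = \<zero>\<^bsub>Q\<^esub>" using hz that by (simp add: a_minus_def)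
    then show ?thesis using that hc Q.M.minus_equality Q.M.minus_minus Q.M.a_inv_closed by metis
  qed
  define k where "k = restrict (\<lambda>X. h (SOME x. x \<in> carrier ?F \<and> ?p x = X)) (carrier ?T)"
  have kp: "k (?p x) = h x" if "x \<in> carrier ?F" for x
  proof -
    define z where "z = (SOME y. y \<in> carrier ?F \<and> ?p y = ?p x)"
    have z: "z \<in> carrier ?F \<and> ?p z = ?p x" unfolding z_def
      by (rule someI[of _ x]) (use that in auto)
    have "?p x \<in> carrier ?T" unfolding qf(3) using that by (rule imageI)
    then have "k (?p x) = h z" unfolding k_def restrict_apply z_def by (rule if_P)
    also have "h z = h x" by (rule wd) (use z that in blast)+
    finally show ?thesis .
  qed
  have pl: "?p (x \<oplus>\<^bsub>?F\<^esub> y) = ?p x \<oplus>\<^bsub>?T\<^esub> ?p y" if "x \<in> carrier ?F" "y \<in> carrier ?F" for x y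
    using qf(2) that by (auto simp: linear_maps_def)
  have ps: "?p (r \<odot>\<^bsub>?F\<^esub> x) = r \<odot>\<^bsub>?T\<^esub> ?p x" if "r \<in> carrier K" "x \<in> carrier ?F" for r x
    using qf(2) that by (auto simp: linear_maps_def)
  have "?P k"
  proof (intro conjI ballI)
    show "k \<in> linear_maps K ?T Q"
      unfolding linear_maps_def qf(3)
    proof (intro CollectI conjI ballI)
      show "k \<in> ?p ` carrier ?F \<rightarrow> carrier Q" using kp hc by auto
      fix X assume "X \<in> ?p ` carrier ?F" then obtain x where x: "x \<in> carrier ?F" "X = ?p x" by blast
      { fix Y assume "Y \<in> ?p ` carrier ?F" then obtain y where y: "y \<in> carrier ?F" "Y = ?p y" by blast
        have "k (X \<oplus>\<^bsub>?T\<^esub> Y) = k (?p (x \<oplus>\<^bsub>?F\<^esub> y))" unfolding x y pl[OF x(1) y(1)] ..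
        also have "\<dots> = h x \<oplus>\<^bsub>Q\<^esub> h y" using x y kp[OF F.M.a_closed[OF x(1) y(1)]] ha by metis
        finally show "k (X \<oplus>\<^bsub>?T\<^esub> Y) = k X \<oplus>\<^bsub>Q\<^esub> k Y" unfolding x y kp[OF x(1)] kp[OF y(1)] . }
      fix r assume r: "r \<in> carrier K"
      have "k (r \<odot>\<^bsub>?T\<^esub> X) = k (?p (r \<odot>\<^bsub>?F\<^esub> x))" unfolding x ps[OF r x(1)] ..
      also have "\<dots> = r \<odot>\<^bsub>Q\<^esub> h x" using x r kp[OF F.smult_closed[OF r x(1)]] hs by metis
      finally show "k (r \<odot>\<^bsub>?T\<^esub> X) = r \<odot>\<^bsub>Q\<^esub> k X" unfolding x kp[OF x(1)] .
    qed
    show "k \<in> extensional (carrier ?T)" by (simp add: k_def)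
    show "k (pure_tensor K M N x y) = b x y" if "x \<in> carrier M" "y \<in> carrier N" for x y
      using kp[OF g[OF that]] hg[OF that] by (simp add: pure_tensor_def)
  qed
  moreover have "k1 = k2" if k1: "?P k1" and k2: "?P k2" for k1 k2
  proof -
    have l1: "k1 \<in> linear_maps K ?T Q" and l2: "k2 \<in> linear_maps K ?T Q" using k1 k2 by auto
    note z1 = linear_zero_minus[OF qf(1) assms(4) l1] and z2 = linear_zero_minus[OF qf(1) assms(4) l2]
    note zp = linear_zero_minus[OF F.module_axioms qf(1,2)]
    have pc: "?p x \<in> carrier ?T" if "x \<in> carrier ?F" for x using that qf(3) by auto
    have a1: "k1 (x \<oplus>\<^bsub>?T\<^esub> y) = k1 x \<oplus>\<^bsub>Q\<^esub> k1 y" "k2 (x \<oplus>\<^bsub>?T\<^esub> y) = k2 x \<oplus>\<^bsub>Q\<^esub> k2 y"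
      if "x \<in> carrier ?T" "y \<in> carrier ?T" for x y using l1 l2 that by (auto simp: linear_maps_def)
    have s1: "k1 (r \<odot>\<^bsub>?T\<^esub> y) = r \<odot>\<^bsub>Q\<^esub> k1 y" "k2 (r \<odot>\<^bsub>?T\<^esub> y) = r \<odot>\<^bsub>Q\<^esub> k2 y"
      if "r \<in> carrier K" "y \<in> carrier ?T" for r y using l1 l2 that by (auto simp: linear_maps_def)
    have "submodule {x \<in> carrier ?F. k1 (?p x) = k2 (?p x)} K ?F"
      by (rule F.submoduleI) (auto simp: zp z1 z2 a1 s1 pc pl ps)
    then have "carrier ?F \<subseteq> {x \<in> carrier ?F. k1 (?p x) = k2 (?p x)}"
      by (rule free_span[OF is_cring]) (use k1 k2 g in \<open>auto simp: pure_tensor_def\<close>)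
    then have "\<And>t. t \<in> carrier ?T \<Longrightarrow> k1 t = k2 t" using qf(3) by auto
    then show "k1 = k2" using k1 k2 by (blast intro: extensionalityI)
  qed
  ultimately show ?thesis by blast
qed

end

theory Submission
  imports Defs
begin

text \<open>
  Put \<open>Q = id - P\<close>. The Rota-Baxter identity of weight \<open>-1\<close> reads
  \<open>(P \<otimes> P) (\<Delta> c) = (P \<otimes> P) (\<Delta> (P c)) - (Q \<otimes> Q) (\<Delta> (P c))\<close>. If \<open>P\<close> is the projection onto
  \<open>C\<^sub>1\<close> along \<open>C\<^sub>2\<close>, this says that \<open>(Q \<otimes> Q) \<circ> \<Delta>\<close> vanishes on \<open>C\<^sub>1\<close> and \<open>(P \<otimes> P) \<circ> \<Delta>\<close> vanishes
  on \<open>C\<^sub>2\<close>. As \<open>C \<otimes> C\<^sub>1 + C\<^sub>1 \<otimes> C\<close> is the kernel of \<open>Q \<otimes> Q\<close>, and \<open>C \<otimes> C\<^sub>2 + C\<^sub>2 \<otimes> C\<close> that of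
  \<open>P \<otimes> P\<close>, these are the two coideal conditions.
\<close>

section \<open>Linear maps and submodules\<close>

lemma linear_mapsD:
  assumes "h \<in> linear_maps K M N"
  shows "x \<in> carrier M \<Longrightarrow> h x \<in> carrier N"
    and "x \<in> carrier M \<Longrightarrow> y \<in> carrier M \<Longrightarrow> h (x \<oplus>\<^bsub>M\<^esub> y) = h x \<oplus>\<^bsub>N\<^esub> h y"
    and "r \<in> carrier K \<Longrightarrow> x \<in> carrier M \<Longrightarrow> h (r \<odot>\<^bsub>M\<^esub> x) = r \<odot>\<^bsub>N\<^esub> h x"
  using assms by (auto simp: linear_maps_def)

lemma linear_maps_id: "id \<in> linear_maps K M M"
  by (auto simp: linear_maps_def)

lemma linear_maps_zero:
  assumes "module K N"
  shows "(\<lambda>x. \<zero>\<^bsub>N\<^esub>) \<in> linear_maps K M N"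
proof -
  interpret N: module K N by fact
  show ?thesis by (auto simp: linear_maps_def)
qed

lemma linear_maps_add:
  assumes "module K M" "module K N" "f \<in> linear_maps K M N" "g \<in> linear_maps K M N"
  shows "(\<lambda>x. f x \<oplus>\<^bsub>N\<^esub> g x) \<in> linear_maps K M N"
proof -
  interpret M: module K M by fact
  interpret N: module K N by fact
  note f = linear_mapsD[OF assms(3)] and g = linear_mapsD[OF assms(4)]
  show ?thesis
    unfolding linear_maps_def by (auto simp: f g N.smult_r_distr N.M.a_ac)
qed

lemma linear_maps_minus:
  assumes "module K M" "module K N" "f \<in> linear_maps K M N" "g \<in> linear_maps K M N"
  shows "(\<lambda>x. f x \<ominus>\<^bsub>N\<^esub> g x) \<in> linear_maps K M N"
proof -
  interpret M: module K M by fact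
  interpret N: module K N by fact
  note f = linear_mapsD[OF assms(3)] and g = linear_mapsD[OF assms(4)]
  show ?thesis
    unfolding linear_maps_def a_minus_def
    by (auto simp: f g N.smult_r_distr N.smult_r_minus N.M.minus_add N.M.a_ac)
qed

section \<open>Submodules obtained as preimages, equalizers and sums\<close>

lemma linear_preimage_submodule:
  assumes "module K M" "module K N" "h \<in> linear_maps K M N" "submodule S K N"
  shows "submodule {x \<in> carrier M. h x \<in> S} K M"
proof -
  interpret M: module K M by fact
  interpret N: module K N by fact
  note h = linear_mapsD[OF assms(3)] linear_zero_minus[OF assms(1-3)]
  note S = N.submoduleE[OF assms(4)]
  have "\<zero>\<^bsub>N\<^esub> \<in> S"
    using assms(4) by (auto simp: submodule_def dest: subgroup.one_closed)
  then show ?thesis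
    by (intro M.submoduleI) (auto simp: h S)
qed

text \<open>Taking \<open>g\<close> to be \<open>id\<close> gives the fixed space of an operator,
  taking it to be zero gives the kernel. The general form also lets two linear maps be compared on a
  spanning set.\<close>

lemma linear_equalizer_submodule:
  assumes "module K M" "module K N" "f \<in> linear_maps K M N" "g \<in> linear_maps K M N"
  shows "submodule {x \<in> carrier M. f x = g x} K M"
proof -
  interpret M: module K M by fact
  interpret N: module K N by fact
  note f = linear_mapsD[OF assms(3)] linear_zero_minus[OF assms(1-3)]
  note g = linear_mapsD[OF assms(4)] linear_zero_minus[OF assms(1,2,4)]
  show ?thesis
    by (intro M.submoduleI) (auto simp: f g)
qed

lemma submodule_set_add:
  assumes "module K M" "submodule A K M" "submodule B K M"
  shows "submodule (A <+>\<^bsub>M\<^esub> B) K M"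
proof -
  interpret M: module K M by fact
  note A = M.submoduleE[OF assms(2)] and B = M.submoduleE[OF assms(3)]
  have z: "\<zero>\<^bsub>M\<^esub> \<in> A" "\<zero>\<^bsub>M\<^esub> \<in> B"
    using assms(2,3) by (auto simp: submodule_def dest: subgroup.one_closed)
  have sum: "x \<in> A <+>\<^bsub>M\<^esub> B \<longleftrightarrow> (\<exists>a\<in>A. \<exists>b\<in>B. x = a \<oplus>\<^bsub>M\<^esub> b)" for x
    by (auto simp: set_add_def')
  have c: "x \<in> carrier M" if "x \<in> A \<or> x \<in> B" for x
    using that A(1) B(1) by auto
  show ?thesis
  proof (rule M.submoduleI)
    show "A <+>\<^bsub>M\<^esub> B \<subseteq> carrier M"
      using c by (auto simp: sum)
    show "\<zero>\<^bsub>M\<^esub> \<in> A <+>\<^bsub>M\<^esub> B"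
      using z by (auto simp: sum intro!: bexI[of _ "\<zero>\<^bsub>M\<^esub>"])
  next
    fix x assume "x \<in> A <+>\<^bsub>M\<^esub> B"
    then obtain a b where x: "a \<in> A" "b \<in> B" "x = a \<oplus>\<^bsub>M\<^esub> b" by (auto simp: sum)
    then have "\<ominus>\<^bsub>M\<^esub> x = \<ominus>\<^bsub>M\<^esub> a \<oplus>\<^bsub>M\<^esub> \<ominus>\<^bsub>M\<^esub> b" using c by (simp add: M.M.minus_add)
    then show "\<ominus>\<^bsub>M\<^esub> x \<in> A <+>\<^bsub>M\<^esub> B" unfolding sum using x A(3) B(3) by blast
    fix y assume "y \<in> A <+>\<^bsub>M\<^esub> B"
    then obtain a' b' where y: "a' \<in> A" "b' \<in> B" "y = a' \<oplus>\<^bsub>M\<^esub> b'" by (auto simp: sum)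
    then have "x \<oplus>\<^bsub>M\<^esub> y = (a \<oplus>\<^bsub>M\<^esub> a') \<oplus>\<^bsub>M\<^esub> (b \<oplus>\<^bsub>M\<^esub> b')" using x c by (simp add: M.M.a_ac)
    then show "x \<oplus>\<^bsub>M\<^esub> y \<in> A <+>\<^bsub>M\<^esub> B" unfolding sum using x y A(5) B(5) by blast
  next
    fix r x assume r: "r \<in> carrier K" and "x \<in> A <+>\<^bsub>M\<^esub> B"
    then obtain a b where x: "a \<in> A" "b \<in> B" "x = a \<oplus>\<^bsub>M\<^esub> b" by (auto simp: sum)
    then have "r \<odot>\<^bsub>M\<^esub> x = r \<odot>\<^bsub>M\<^esub> a \<oplus>\<^bsub>M\<^esub> r \<odot>\<^bsub>M\<^esub> b" using r c by (simp add: M.smult_r_distr)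
    then show "r \<odot>\<^bsub>M\<^esub> x \<in> A <+>\<^bsub>M\<^esub> B" unfolding sum using r x A(4) B(4) by blast
  qed
qed

lemma set_add_least:
  assumes "module K M" "submodule S K M" "A \<subseteq> S" "B \<subseteq> S"
  shows "A <+>\<^bsub>M\<^esub> B \<subseteq> S"
proof
  interpret M: module K M by fact
  fix x assume "x \<in> A <+>\<^bsub>M\<^esub> B"
  then obtain a b where "a \<in> A" "b \<in> B" "x = a \<oplus>\<^bsub>M\<^esub> b" by (auto simp: set_add_def')
  then show "x \<in> S" using assms(3,4) M.submoduleE(5)[OF assms(2)] by auto
qed

lemma submodule_span_superset: "S \<subseteq> submodule_span K M S"
  by (auto simp: submodule_span_def)

text \<open>Every x splits as P x + (x - P x): idempotence makes P fix the first summand and kill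
  the second. A vector that is both fixed and killed is zero.\<close>

lemma idempotent_direct_sum:
  assumes M: "module K M" and P: "P \<in> linear_maps K M M"
    and idem: "\<And>x. x \<in> carrier M \<Longrightarrow> P (P x) = P x"
  shows "direct_sum_decomposition K M {x \<in> carrier M. P x = x} {x \<in> carrier M. P x = \<zero>\<^bsub>M\<^esub>}"
    (is "direct_sum_decomposition K M ?A ?B")
proof -
  interpret M: module K M by fact
  note Pl = linear_mapsD[OF P] linear_zero_minus[OF M M P]
  have "submodule ?A K M"
    using linear_equalizer_submodule[OF M M P linear_maps_id] by simp
  moreover have "submodule ?B K M"
    using linear_equalizer_submodule[OF M M P linear_maps_zero[OF M]] .
  moreover have "?A <+>\<^bsub>M\<^esub> ?B = carrier M"
  proof
    show "?A <+>\<^bsub>M\<^esub> ?B \<subseteq> carrier M" by (auto simp: set_add_def')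
    show "carrier M \<subseteq> ?A <+>\<^bsub>M\<^esub> ?B"
    proof
      fix x assume x: "x \<in> carrier M"
      have "x = P x \<oplus>\<^bsub>M\<^esub> (x \<ominus>\<^bsub>M\<^esub> P x)"
        using x by (simp add: Pl a_minus_def M.M.a_lcomm M.M.r_neg)
      moreover have "P x \<in> ?A" using x by (simp add: Pl idem)
      moreover have "x \<ominus>\<^bsub>M\<^esub> P x \<in> ?B" using x by (simp add: Pl idem a_minus_def M.M.r_neg)
      ultimately show "x \<in> ?A <+>\<^bsub>M\<^esub> ?B" unfolding set_add_def' by blast
    qed
  qed
  moreover have "?A \<inter> ?B = {\<zero>\<^bsub>M\<^esub>}" using Pl(4) by auto
  ultimately show ?thesis by (simp add: direct_sum_decomposition_def)
qed

section \<open>Tensor products\<close>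

text \<open>Bundling a field with two vector spaces allows the free module \<open>F\<close> and its
  quotient \<open>T\<close> to be registered as modules once and for all. The coalgebra case is the
  instance where both factors are \<open>C\<close>.\<close>

locale tensor_factors = K: field K + M: module K M + N: module K N
  for K :: "('k, 'r) ring_scheme" and M :: "('k, 'a, 'm) module_scheme"
    and N :: "('k, 'b, 'n) module_scheme"
begin

abbreviation F where "F \<equiv> free_module K (carrier M \<times> carrier N)"
abbreviation T where "T \<equiv> tensor_product K M N"
abbreviation tensor (infixl "\<otimes>\<^sub>T" 75) where "x \<otimes>\<^sub>T y \<equiv> pure_tensor K M N x y"

sublocale F: module K F
  by (rule free_module_module) (rule K.is_cring)

lemma tensor_kernel_submodule: "submodule (tensor_kernel K M N) K F"
  unfolding tensor_kernel_def
  by (rule submodule_span_submodule[OF F.module_axioms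
        tensor_relations_in[OF M.module_axioms N.module_axioms]])

text \<open>The items are used by position: \<open>T\<close> is a module; the coset map from
  \<open>F\<close> is linear; it is onto; two cosets agree iff the difference of their
  representatives lies in the kernel.\<close>

lemmas tensor_quotient =
  quotient_facts[OF F.module_axioms tensor_kernel_submodule, folded tensor_product_def]

sublocale T: module K T
  by (rule tensor_quotient(1))

lemma free_gen_closed [simp]: "x \<in> carrier M \<Longrightarrow> y \<in> carrier N \<Longrightarrow> free_gen K (x, y) \<in> carrier F"
  using K.is_cring by (auto intro!: free_gen_in)

lemma pure_tensor_closed [simp]: "x \<in> carrier M \<Longrightarrow> y \<in> carrier N \<Longrightarrow> x \<otimes>\<^sub>T y \<in> carrier T"
  by (simp add: pure_tensor_def tensor_quotient(3))

text \<open>Each defining relation lies in the span that is factored out, so its two sides have the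
  same coset. The bilinearity laws of pure tensors are the four families of relations read through
  this fact.\<close>

lemma coset_eq_of_relation:
  assumes "a \<ominus>\<^bsub>F\<^esub> b \<in> tensor_relations K M N" "a \<in> carrier F" "b \<in> carrier F"
  shows "tensor_kernel K M N +>\<^bsub>F\<^esub> a = tensor_kernel K M N +>\<^bsub>F\<^esub> b"
  unfolding tensor_quotient(4)[OF assms(2,3)] unfolding tensor_kernel_def
  by (rule subsetD[OF submodule_span_superset assms(1)])

section \<open>Bilinearity of pure tensors\<close>

lemma pure_tensor_add_left:
  assumes "x \<in> carrier M" "x' \<in> carrier M" "y \<in> carrier N"
  shows "(x \<oplus>\<^bsub>M\<^esub> x') \<otimes>\<^sub>T y = x \<otimes>\<^sub>T y \<oplus>\<^bsub>T\<^esub> x' \<otimes>\<^sub>T y"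
proof -
  have "free_gen K (x \<oplus>\<^bsub>M\<^esub> x', y) \<ominus>\<^bsub>F\<^esub> (free_gen K (x, y) \<oplus>\<^bsub>F\<^esub> free_gen K (x', y))
      \<in> tensor_relations K M N"
    unfolding tensor_relations_def Let_def using assms by blast
  from coset_eq_of_relation[OF this] show ?thesis
    using assms linear_mapsD(2)[OF tensor_quotient(2)] by (simp add: pure_tensor_def)
qed

lemma pure_tensor_add_right:
  assumes "x \<in> carrier M" "y \<in> carrier N" "y' \<in> carrier N"
  shows "x \<otimes>\<^sub>T (y \<oplus>\<^bsub>N\<^esub> y') = x \<otimes>\<^sub>T y \<oplus>\<^bsub>T\<^esub> x \<otimes>\<^sub>T y'"
proof -
  have "free_gen K (x, y \<oplus>\<^bsub>N\<^esub> y') \<ominus>\<^bsub>F\<^esub> (free_gen K (x, y) \<oplus>\<^bsub>F\<^esub> free_gen K (x, y'))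
      \<in> tensor_relations K M N"
    unfolding tensor_relations_def Let_def using assms by blast
  from coset_eq_of_relation[OF this] show ?thesis
    using assms linear_mapsD(2)[OF tensor_quotient(2)] by (simp add: pure_tensor_def)
qed

lemma pure_tensor_smult_left:
  assumes "r \<in> carrier K" "x \<in> carrier M" "y \<in> carrier N"
  shows "(r \<odot>\<^bsub>M\<^esub> x) \<otimes>\<^sub>T y = r \<odot>\<^bsub>T\<^esub> (x \<otimes>\<^sub>T y)"
proof -
  have "free_gen K (r \<odot>\<^bsub>M\<^esub> x, y) \<ominus>\<^bsub>F\<^esub> (r \<odot>\<^bsub>F\<^esub> free_gen K (x, y)) \<in> tensor_relations K M N"
    unfolding tensor_relations_def Let_def using assms by blast
  from coset_eq_of_relation[OF this] show ?thesis
    using assms linear_mapsD(3)[OF tensor_quotient(2)] by (simp add: pure_tensor_def)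
qed

lemma pure_tensor_smult_right:
  assumes "r \<in> carrier K" "x \<in> carrier M" "y \<in> carrier N"
  shows "x \<otimes>\<^sub>T (r \<odot>\<^bsub>N\<^esub> y) = r \<odot>\<^bsub>T\<^esub> (x \<otimes>\<^sub>T y)"
proof -
  have "free_gen K (x, r \<odot>\<^bsub>N\<^esub> y) \<ominus>\<^bsub>F\<^esub> (r \<odot>\<^bsub>F\<^esub> free_gen K (x, y)) \<in> tensor_relations K M N"
    unfolding tensor_relations_def Let_def using assms by blast
  from coset_eq_of_relation[OF this] show ?thesis
    using assms linear_mapsD(3)[OF tensor_quotient(2)] by (simp add: pure_tensor_def)
qed

lemma pure_tensor_linear_left: "y \<in> carrier N \<Longrightarrow> (\<lambda>x. x \<otimes>\<^sub>T y) \<in> linear_maps K M T"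
  by (auto simp: linear_maps_def pure_tensor_add_left pure_tensor_smult_left)

lemma pure_tensor_linear_right: "x \<in> carrier M \<Longrightarrow> (\<lambda>y. x \<otimes>\<^sub>T y) \<in> linear_maps K N T"
  by (auto simp: linear_maps_def pure_tensor_add_right pure_tensor_smult_right)

lemmas pure_tensor_left =
  linear_zero_minus[OF M.module_axioms T.module_axioms pure_tensor_linear_left]

lemmas pure_tensor_right =
  linear_zero_minus[OF N.module_axioms T.module_axioms pure_tensor_linear_right]

text \<open>Pull \<open>S\<close> back along the coset map: the result is a submodule of
  \<open>F\<close> containing all free generators, hence all of \<open>F\<close>. Surjectivity of
  the coset map carries this over to \<open>T\<close>.\<close>

lemma tensor_span:
  assumes "submodule S K T" "\<And>x y. x \<in> carrier M \<Longrightarrow> y \<in> carrier N \<Longrightarrow> x \<otimes>\<^sub>T y \<in> S"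
  shows "carrier T \<subseteq> S"
proof -
  let ?p = "\<lambda>u. tensor_kernel K M N +>\<^bsub>F\<^esub> u"
  have "submodule {u \<in> carrier F. ?p u \<in> S} K F"
    by (rule linear_preimage_submodule[OF F.module_axioms T.module_axioms tensor_quotient(2) assms(1)])
  then have "carrier F \<subseteq> {u \<in> carrier F. ?p u \<in> S}"
    by (rule free_span[OF K.is_cring]) (use assms(2) in \<open>auto simp: pure_tensor_def\<close>)
  then show ?thesis using tensor_quotient(3) by auto
qed

text \<open>The equalizer of the two maps is a submodule containing every pure tensor, so it is
  everything.\<close>

lemma tensor_linear_eqI:
  assumes "module K Q" "f \<in> linear_maps K T Q" "g \<in> linear_maps K T Q"
    and "\<And>x y. x \<in> carrier M \<Longrightarrow> y \<in> carrier N \<Longrightarrow> f (x \<otimes>\<^sub>T y) = g (x \<otimes>\<^sub>T y)"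
    and "t \<in> carrier T"
  shows "f t = g t"
proof -
  have "carrier T \<subseteq> {t \<in> carrier T. f t = g t}"
    by (rule tensor_span[OF linear_equalizer_submodule[OF T.module_axioms assms(1-3)]])
      (simp add: assms(4))
  then show ?thesis using assms(5) by auto
qed

section \<open>Tensor products of subspaces inside \<open>T\<close>\<close>

lemma tensor_subspace_submodule:
  assumes "A \<subseteq> carrier M" "B \<subseteq> carrier N"
  shows "submodule (tensor_subspace K M N A B) K T"
  unfolding tensor_subspace_def
  by (rule submodule_span_submodule[OF T.module_axioms]) (use assms in \<open>auto intro!: pure_tensor_closed\<close>)

lemma pure_tensor_in_subspace:
  "x \<in> A \<Longrightarrow> y \<in> B \<Longrightarrow> x \<otimes>\<^sub>T y \<in> tensor_subspace K M N A B"
  unfolding tensor_subspace_def by (rule subsetD[OF submodule_span_superset]) blast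

lemma tensor_subspace_least:
  assumes "submodule S K T" "\<And>x y. x \<in> A \<Longrightarrow> y \<in> B \<Longrightarrow> x \<otimes>\<^sub>T y \<in> S"
  shows "tensor_subspace K M N A B \<subseteq> S"
  unfolding tensor_subspace_def
  by (rule subsetI, erule submodule_span_induct[OF _ assms(1)]) (use assms(2) in auto)

end

text \<open>\<open>tensor_map\<close> is built on a definite description, so nothing can be said
  about it before unique existence is known. The universal property supplies this, since (x, y)
  \<mapsto> f x \<otimes> g y is bilinear.\<close>

lemma tensor_map_facts:
  assumes "tensor_factors K M N" "tensor_factors K M' N'"
    and f: "f \<in> linear_maps K M M'" and g: "g \<in> linear_maps K N N'"
  shows tensor_map_linear: "tensor_map K M N M' N' f g
      \<in> linear_maps K (tensor_product K M N) (tensor_product K M' N')"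
    and tensor_map_pure: "\<And>x y. x \<in> carrier M \<Longrightarrow> y \<in> carrier N \<Longrightarrow>
      tensor_map K M N M' N' f g (pure_tensor K M N x y) = pure_tensor K M' N' (f x) (g y)"
proof -
  interpret A: tensor_factors K M N by fact
  interpret B: tensor_factors K M' N' by fact
  note lin = linear_mapsD[OF f] linear_mapsD[OF g]
  have "\<exists>!h. h \<in> linear_maps K A.T B.T \<and> h \<in> extensional (carrier A.T) \<and>
      (\<forall>x\<in>carrier M. \<forall>y\<in>carrier N. h (A.tensor x y) = B.tensor (f x) (g y))"
    by (rule tensor_universal[OF A.K.field_axioms A.M.module_axioms A.N.module_axioms B.T.module_axioms])
      (simp_all add: lin B.pure_tensor_add_left B.pure_tensor_add_right
        B.pure_tensor_smult_left B.pure_tensor_smult_right)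
  note h = theI'[OF this, folded tensor_lift_def, folded tensor_map_def]
  show "tensor_map K M N M' N' f g \<in> linear_maps K A.T B.T"
    using h by blast
  show "tensor_map K M N M' N' f g (A.tensor x y) = B.tensor (f x) (g y)"
    if "x \<in> carrier M" "y \<in> carrier N" for x y
    using h that by blast
qed

section \<open>Coideals and Rota-Baxter operators\<close>

context coalgebra
begin

sublocale tensor_factors K C C ..

notation tensor (infixl "\<otimes>\<^sub>T" 75)

abbreviation tmap where "tmap \<equiv> tensor_map K C C C C"

lemmas tmap_linear = tensor_map_linear[OF tensor_factors_axioms tensor_factors_axioms]
lemmas tmap_pure = tensor_map_pure[OF tensor_factors_axioms tensor_factors_axioms]

lemma coproduct_closed [simp]: "c \<in> carrier C \<Longrightarrow> \<Delta> c \<in> carrier T"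
  using linear_mapsD(1)[OF coproduct_linear] .

text \<open>The hypotheses say that Q is a projection with kernel \<open>J\<close>. Then Q \<otimes>
  Q kills both summands. Conversely, id - Q \<otimes> Q maps all of \<open>T\<close> into their sum,
  and it fixes every tensor that Q \<otimes> Q kills.\<close>

lemma tmap_kernel:
  assumes Q: "Q \<in> linear_maps K C C" and J: "submodule J K C"
    and vanish: "\<And>x. x \<in> J \<Longrightarrow> Q x = \<zero>\<^bsub>C\<^esub>"
    and diff: "\<And>x. x \<in> carrier C \<Longrightarrow> x \<ominus>\<^bsub>C\<^esub> Q x \<in> J"
  shows "{t \<in> carrier T. tmap Q Q t = \<zero>\<^bsub>T\<^esub>}
    = tensor_subspace K C C (carrier C) J <+>\<^bsub>T\<^esub> tensor_subspace K C C J (carrier C)"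
    (is "?ker = ?A <+>\<^bsub>T\<^esub> ?B")
proof
  have Jc: "J \<subseteq> carrier C" by (rule C.submoduleE(1)[OF J])
  have A: "submodule ?A K T" and B: "submodule ?B K T"
    by (rule tensor_subspace_submodule; use Jc in simp)+
  have AB: "submodule (?A <+>\<^bsub>T\<^esub> ?B) K T" by (rule submodule_set_add[OF T.module_axioms A B])
  note Qc = linear_mapsD(1)[OF Q]
  note QQ = tmap_linear[OF Q Q]
  have ker: "submodule ?ker K T"
    by (rule linear_equalizer_submodule[OF T.module_axioms T.module_axioms QQ
          linear_maps_zero[OF T.module_axioms]])
  have "?A \<subseteq> ?ker"
    by (rule tensor_subspace_least[OF ker])
      (use Jc in \<open>auto simp: tmap_pure[OF Q Q] vanish pure_tensor_right Qc\<close>)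
  moreover have "?B \<subseteq> ?ker"
    by (rule tensor_subspace_least[OF ker])
      (use Jc in \<open>auto simp: tmap_pure[OF Q Q] vanish pure_tensor_left Qc\<close>)
  ultimately show "?A <+>\<^bsub>T\<^esub> ?B \<subseteq> ?ker"
    by (rule set_add_least[OF T.module_axioms ker])
  have "carrier T \<subseteq> {t \<in> carrier T. id t \<ominus>\<^bsub>T\<^esub> tmap Q Q t \<in> ?A <+>\<^bsub>T\<^esub> ?B}"
  proof (rule tensor_span)
    show "submodule {t \<in> carrier T. id t \<ominus>\<^bsub>T\<^esub> tmap Q Q t \<in> ?A <+>\<^bsub>T\<^esub> ?B} K T"
      by (rule linear_preimage_submodule[OF T.module_axioms T.module_axioms _ AB])
        (rule linear_maps_minus[OF T.module_axioms T.module_axioms linear_maps_id QQ])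
    fix x y assume xy: "x \<in> carrier C" "y \<in> carrier C"
    \<comment> \<open>Change one factor at a time: inserting Q x \<otimes> y between the two terms
      leaves one difference in the second factor and one in the first, each with an entry in
      \<open>J\<close>.\<close>
    have "x \<otimes>\<^sub>T y \<ominus>\<^bsub>T\<^esub> Q x \<otimes>\<^sub>T Q y
        = Q x \<otimes>\<^sub>T (y \<ominus>\<^bsub>C\<^esub> Q y) \<oplus>\<^bsub>T\<^esub> (x \<ominus>\<^bsub>C\<^esub> Q x) \<otimes>\<^sub>T y"
      using xy by (simp add: pure_tensor_left pure_tensor_right
          pure_tensor_add_left pure_tensor_add_right Qc a_minus_def T.M.a_ac T.M.r_neg1 T.M.r_neg2)
    moreover have "Q x \<otimes>\<^sub>T (y \<ominus>\<^bsub>C\<^esub> Q y) \<in> ?A" "(x \<ominus>\<^bsub>C\<^esub> Q x) \<otimes>\<^sub>T y \<in> ?B"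
      using xy diff Qc by (auto intro!: pure_tensor_in_subspace)
    ultimately show "x \<otimes>\<^sub>T y \<in> {t \<in> carrier T. id t \<ominus>\<^bsub>T\<^esub> tmap Q Q t \<in> ?A <+>\<^bsub>T\<^esub> ?B}"
      using xy unfolding set_add_def' by (auto simp: tmap_pure[OF Q Q])
  qed
  then have "t \<ominus>\<^bsub>T\<^esub> tmap Q Q t \<in> ?A <+>\<^bsub>T\<^esub> ?B" if "t \<in> carrier T" for t
    using that by auto
  moreover have "t \<ominus>\<^bsub>T\<^esub> \<zero>\<^bsub>T\<^esub> = t" if "t \<in> carrier T" for t
    using that by (simp add: a_minus_def)
  ultimately show "?ker \<subseteq> ?A <+>\<^bsub>T\<^esub> ?B"
    by fastforce
qed

text \<open>Replaces membership in a sum of tensor subspaces by an equation: the sum is the kernel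
  of Q \<otimes> Q for any projection Q with kernel \<open>J\<close>.\<close>

lemma noncounitary_coideal_iff:
  assumes "Q \<in> linear_maps K C C" "submodule J K C"
    and "\<And>x. x \<in> J \<Longrightarrow> Q x = \<zero>\<^bsub>C\<^esub>"
    and "\<And>x. x \<in> carrier C \<Longrightarrow> x \<ominus>\<^bsub>C\<^esub> Q x \<in> J"
  shows "noncounitary_coideal K C \<Delta> J \<longleftrightarrow> (\<forall>x\<in>J. tmap Q Q (\<Delta> x) = \<zero>\<^bsub>T\<^esub>)"
proof -
  have ker: "{t \<in> carrier T. tmap Q Q t = \<zero>\<^bsub>T\<^esub>}
      = tensor_subspace K C C (carrier C) J <+>\<^bsub>T\<^esub> tensor_subspace K C C J (carrier C)"
    by (rule tmap_kernel) fact+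
  have "\<Delta> x \<in> carrier T" if "x \<in> J" for x
    using that C.submoduleE(1)[OF assms(2)] by auto
  then show ?thesis
    using assms(2) by (simp add: noncounitary_coideal_def image_subset_iff flip: ker)
qed

text \<open>Expanding (id - P) \<otimes> (id - P) on pure tensors gives id \<otimes> P + P \<otimes>
  id - id = P \<otimes> P - Q \<otimes> Q on all of \<open>T\<close>. Evaluated at \<Delta> (P c),
  the left side is the right side of the Rota-Baxter identity.\<close>

lemma rota_baxter_operator_minus_one_iff:
  assumes P: "P \<in> linear_maps K C C"
  defines "Q \<equiv> \<lambda>x. x \<ominus>\<^bsub>C\<^esub> P x"
  shows "rota_baxter_operator K C \<Delta> (\<ominus>\<^bsub>K\<^esub> \<one>\<^bsub>K\<^esub>) P \<longleftrightarrow>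
    (\<forall>c\<in>carrier C. tmap P P (\<Delta> c) = tmap P P (\<Delta> (P c)) \<ominus>\<^bsub>T\<^esub> tmap Q Q (\<Delta> (P c)))"
proof -
  have Q: "Q \<in> linear_maps K C C"
    using linear_maps_minus[OF C.module_axioms C.module_axioms linear_maps_id P] by (simp add: Q_def)
  note Pc = linear_mapsD(1)[OF P]
  note lin = linear_maps_add[OF T.module_axioms T.module_axioms]
    linear_maps_minus[OF T.module_axioms T.module_axioms] tmap_linear linear_maps_id P Q
  have "tmap id P t \<oplus>\<^bsub>T\<^esub> tmap P id t \<ominus>\<^bsub>T\<^esub> id t = tmap P P t \<ominus>\<^bsub>T\<^esub> tmap Q Q t" if "t \<in> carrier T" for t
  proof (rule tensor_linear_eqI[OF T.module_axioms _ _ _ that])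
    show "(\<lambda>t. tmap id P t \<oplus>\<^bsub>T\<^esub> tmap P id t \<ominus>\<^bsub>T\<^esub> id t) \<in> linear_maps K T T"
      "(\<lambda>t. tmap P P t \<ominus>\<^bsub>T\<^esub> tmap Q Q t) \<in> linear_maps K T T"
      by (intro lin)+
    \<comment> \<open>Sorting the summands can leave a term separated from its negative; this rule
      cancels the two across the summand between them.\<close>
    have cancel: "u \<oplus>\<^bsub>T\<^esub> (v \<oplus>\<^bsub>T\<^esub> \<ominus>\<^bsub>T\<^esub> u) = v" if "u \<in> carrier T" "v \<in> carrier T" for u v
      using that by (simp add: T.M.a_lcomm[of u v] T.M.r_neg)
    fix x y assume "x \<in> carrier C" "y \<in> carrier C"
    then show "tmap id P (x \<otimes>\<^sub>T y) \<oplus>\<^bsub>T\<^esub> tmap P id (x \<otimes>\<^sub>T y) \<ominus>\<^bsub>T\<^esub> id (x \<otimes>\<^sub>T y)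
        = tmap P P (x \<otimes>\<^sub>T y) \<ominus>\<^bsub>T\<^esub> tmap Q Q (x \<otimes>\<^sub>T y)"
      by (simp add: tmap_pure lin)
        (simp add: Q_def pure_tensor_left pure_tensor_right
          pure_tensor_add_left pure_tensor_add_right Pc a_minus_def
          T.M.minus_add T.M.a_ac T.M.r_neg1 T.M.r_neg2 cancel)
  qed
  \<comment> \<open>The weight -1 turns the scalar multiple in the Rota-Baxter identity into a
    subtraction.\<close>
  moreover have "(\<ominus>\<^bsub>K\<^esub> \<one>\<^bsub>K\<^esub>) \<odot>\<^bsub>T\<^esub> t = \<ominus>\<^bsub>T\<^esub> t" if "t \<in> carrier T" for t
    using that by (simp add: T.smult_l_minus)
  ultimately show ?thesis
    unfolding rota_baxter_operator_def Let_def using P Pc by (simp add: a_minus_def)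
qed

text \<open>At c = a + b with a in \<open>C\<^sub>1\<close> and b in \<open>C\<^sub>2\<close>, the
  rewritten identity collapses to (P \<otimes> P) (\<Delta> b) = - (Q \<otimes> Q) (\<Delta> a). As
  a and b vary independently and may be zero, this holds throughout iff both sides always
  vanish.\<close>

lemma projection_rota_baxter_iff:
  assumes P: "P \<in> linear_maps K C C" and dec: "direct_sum_decomposition K C C\<^sub>1 C\<^sub>2"
    and P1: "\<And>x. x \<in> C\<^sub>1 \<Longrightarrow> P x = x" and P2: "\<And>x. x \<in> C\<^sub>2 \<Longrightarrow> P x = \<zero>\<^bsub>C\<^esub>"
  shows "rota_baxter_operator K C \<Delta> (\<ominus>\<^bsub>K\<^esub> \<one>\<^bsub>K\<^esub>) P \<longleftrightarrow>
    noncounitary_coideal K C \<Delta> C\<^sub>1 \<and> noncounitary_coideal K C \<Delta> C\<^sub>2"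
proof -
  define Q where "Q = (\<lambda>x. x \<ominus>\<^bsub>C\<^esub> P x)"
  have Q: "Q \<in> linear_maps K C C"
    using linear_maps_minus[OF C.module_axioms C.module_axioms linear_maps_id P] by (simp add: Q_def)
  have sub: "submodule C\<^sub>1 K C" "submodule C\<^sub>2 K C" and sum: "C\<^sub>1 <+>\<^bsub>C\<^esub> C\<^sub>2 = carrier C"
    using dec by (auto simp: direct_sum_decomposition_def)
  have car: "x \<in> carrier C" if "x \<in> C\<^sub>1 \<or> x \<in> C\<^sub>2" for x
    using that C.submoduleE(1)[OF sub(1)] C.submoduleE(1)[OF sub(2)] by auto
  have split: "\<exists>a\<in>C\<^sub>1. \<exists>b\<in>C\<^sub>2. x = a \<oplus>\<^bsub>C\<^esub> b" if "x \<in> carrier C" for x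
    using that unfolding sum[symmetric] by (auto simp: set_add_def')
  note Pl = linear_mapsD[OF P] and \<Delta>l = linear_mapsD[OF coproduct_linear]
  have val: "P (a \<oplus>\<^bsub>C\<^esub> b) = a" "Q (a \<oplus>\<^bsub>C\<^esub> b) = b" if "a \<in> C\<^sub>1" "b \<in> C\<^sub>2" for a b
  proof -
    show *: "P (a \<oplus>\<^bsub>C\<^esub> b) = a" using that car by (simp add: Pl P1 P2)
    show "Q (a \<oplus>\<^bsub>C\<^esub> b) = b"
      unfolding Q_def * using that car by (simp add: a_minus_def C.M.a_assoc C.M.a_comm[of a b] C.M.r_neg)
  qed
  note TT = T.module_axioms
  note PP = linear_mapsD[OF tmap_linear[OF P P]] linear_zero_minus[OF TT TT tmap_linear[OF P P]]
  note QQ = linear_mapsD[OF tmap_linear[OF Q Q]] linear_zero_minus[OF TT TT tmap_linear[OF Q Q]]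
  have \<Delta>0: "\<Delta> \<zero>\<^bsub>C\<^esub> = \<zero>\<^bsub>T\<^esub>"
    by (rule linear_zero_minus[OF C.module_axioms TT coproduct_linear])
  \<comment> \<open>The roles cross over: \<open>C\<^sub>1\<close> is the kernel of Q and
    \<open>C\<^sub>2\<close> that of P, so the coideal criterion for each summand uses the
    projection onto the other.\<close>
  have "x \<ominus>\<^bsub>C\<^esub> Q x \<in> C\<^sub>1" "x \<ominus>\<^bsub>C\<^esub> P x \<in> C\<^sub>2" if x: "x \<in> carrier C" for x
  proof -
    obtain a b where ab: "a \<in> C\<^sub>1" "b \<in> C\<^sub>2" "x = a \<oplus>\<^bsub>C\<^esub> b" using split[OF x] by blast
    have "x \<ominus>\<^bsub>C\<^esub> P x = b" using val(2)[OF ab(1,2)] by (simp add: Q_def ab(3))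
    then show "x \<ominus>\<^bsub>C\<^esub> P x \<in> C\<^sub>2" using ab(2) by simp
    show "x \<ominus>\<^bsub>C\<^esub> Q x \<in> C\<^sub>1"
      unfolding ab(3) val[OF ab(1,2)] using ab car
      by (simp add: a_minus_def C.M.a_assoc C.M.r_neg)
  qed
  then have coideal1: "noncounitary_coideal K C \<Delta> C\<^sub>1 \<longleftrightarrow> (\<forall>x\<in>C\<^sub>1. tmap Q Q (\<Delta> x) = \<zero>\<^bsub>T\<^esub>)"
    and coideal2: "noncounitary_coideal K C \<Delta> C\<^sub>2 \<longleftrightarrow> (\<forall>x\<in>C\<^sub>2. tmap P P (\<Delta> x) = \<zero>\<^bsub>T\<^esub>)"
    using noncounitary_coideal_iff[OF Q sub(1)] noncounitary_coideal_iff[OF P sub(2)] P2 P1 car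
    by (auto simp: Q_def a_minus_def C.M.r_neg)
  show ?thesis
    unfolding rota_baxter_operator_minus_one_iff[OF P, folded Q_def] coideal1 coideal2
  proof (intro iffI conjI ballI)
    assume RB: "\<forall>c\<in>carrier C. tmap P P (\<Delta> c) = tmap P P (\<Delta> (P c)) \<ominus>\<^bsub>T\<^esub> tmap Q Q (\<Delta> (P c))"
    show "tmap Q Q (\<Delta> x) = \<zero>\<^bsub>T\<^esub>" if x: "x \<in> C\<^sub>1" for x
    proof -
      \<comment> \<open>Take c = x. As P x = x, the terms with P \<otimes> P on the two sides
        coincide and cancel.\<close>
      have "tmap P P (\<Delta> (P x)) \<ominus>\<^bsub>T\<^esub> tmap Q Q (\<Delta> (P x)) = tmap P P (\<Delta> x)"
        using RB x car by simp
      then have "\<ominus>\<^bsub>T\<^esub> tmap Q Q (\<Delta> x) = \<zero>\<^bsub>T\<^esub>"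
        unfolding P1[OF x] a_minus_def using x car PP(1) QQ(1)
        by (simp add: T.M.add.l_cancel_one)
      then show ?thesis
        using x car QQ(1) by (simp add: T.M.add.inv_eq_1_iff)
    qed
    \<comment> \<open>Here P x = 0, so the whole right side of the identity is zero.\<close>
    show "tmap P P (\<Delta> x) = \<zero>\<^bsub>T\<^esub>" if x: "x \<in> C\<^sub>2" for x
      using RB x car by (simp add: P2 \<Delta>0 PP QQ a_minus_def)
  next
    assume *: "(\<forall>x\<in>C\<^sub>1. tmap Q Q (\<Delta> x) = \<zero>\<^bsub>T\<^esub>) \<and> (\<forall>x\<in>C\<^sub>2. tmap P P (\<Delta> x) = \<zero>\<^bsub>T\<^esub>)"
    fix c assume "c \<in> carrier C"
    then obtain a b where ab: "a \<in> C\<^sub>1" "b \<in> C\<^sub>2" "c = a \<oplus>\<^bsub>C\<^esub> b" using split by blast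
    \<comment> \<open>With P c = a, the term with Q \<otimes> Q vanishes on the right, and on the
      left \<Delta> b contributes nothing.\<close>
    show "tmap P P (\<Delta> c) = tmap P P (\<Delta> (P c)) \<ominus>\<^bsub>T\<^esub> tmap Q Q (\<Delta> (P c))"
      unfolding ab(3) val[OF ab(1,2)] using ab car * by (simp add: \<Delta>l PP a_minus_def)
  qed
qed

end

theorem proposition3p9:
  fixes K :: "('k, 'r) ring_scheme" and C :: "('k, 'c, 'm) module_scheme"
    and \<Delta> :: "'c \<Rightarrow> ('c \<times> 'c \<Rightarrow> 'k) set" and P :: "'c \<Rightarrow> 'c"
  assumes char_0: "\<And>n::nat. 0 < n \<Longrightarrow> [n] \<cdot>\<^bsub>K\<^esub> \<one>\<^bsub>K\<^esub> \<noteq> \<zero>\<^bsub>K\<^esub>"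
    and coalgebra: "coalgebra K C \<Delta>"
    and linear: "P \<in> linear_maps K C C"
  shows "rota_baxter_operator K C \<Delta> (\<ominus>\<^bsub>K\<^esub> \<one>\<^bsub>K\<^esub>) P \<and> (\<forall>c\<in>carrier C. P (P c) = P c) \<longleftrightarrow>
    (\<exists>C\<^sub>1 C\<^sub>2. direct_sum_decomposition K C C\<^sub>1 C\<^sub>2 \<and>
       noncounitary_coideal K C \<Delta> C\<^sub>1 \<and> noncounitary_coideal K C \<Delta> C\<^sub>2 \<and>
       (\<forall>c\<^sub>1\<in>C\<^sub>1. \<forall>c\<^sub>2\<in>C\<^sub>2. P (c\<^sub>1 \<oplus>\<^bsub>C\<^esub> c\<^sub>2) = c\<^sub>1))"
proof -
  interpret coalgebra K C \<Delta> by fact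
  note Pl = linear_mapsD[OF linear]
  show ?thesis
  proof
    \<comment> \<open>The decomposition is forced: an idempotent projects onto its fixed space along
      its kernel.\<close>
    let ?A = "{x \<in> carrier C. P x = x}" and ?B = "{x \<in> carrier C. P x = \<zero>\<^bsub>C\<^esub>}"
    assume P: "rota_baxter_operator K C \<Delta> (\<ominus>\<^bsub>K\<^esub> \<one>\<^bsub>K\<^esub>) P \<and> (\<forall>c\<in>carrier C. P (P c) = P c)"
    then have dec: "direct_sum_decomposition K C ?A ?B"
      using idempotent_direct_sum[OF C.module_axioms linear] by blast
    moreover have "rota_baxter_operator K C \<Delta> (\<ominus>\<^bsub>K\<^esub> \<one>\<^bsub>K\<^esub>) P \<longleftrightarrow>
        noncounitary_coideal K C \<Delta> ?A \<and> noncounitary_coideal K C \<Delta> ?B"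
      by (rule projection_rota_baxter_iff[OF linear dec]) auto
    moreover have "\<forall>a\<in>?A. \<forall>b\<in>?B. P (a \<oplus>\<^bsub>C\<^esub> b) = a"
      by (simp add: Pl)
    ultimately show "\<exists>C\<^sub>1 C\<^sub>2. direct_sum_decomposition K C C\<^sub>1 C\<^sub>2 \<and>
       noncounitary_coideal K C \<Delta> C\<^sub>1 \<and> noncounitary_coideal K C \<Delta> C\<^sub>2 \<and>
       (\<forall>c\<^sub>1\<in>C\<^sub>1. \<forall>c\<^sub>2\<in>C\<^sub>2. P (c\<^sub>1 \<oplus>\<^bsub>C\<^esub> c\<^sub>2) = c\<^sub>1)"
      using P by (intro exI[of _ ?A] exI[of _ ?B]) simp
  next
    assume "\<exists>C\<^sub>1 C\<^sub>2. direct_sum_decomposition K C C\<^sub>1 C\<^sub>2 \<and>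
       noncounitary_coideal K C \<Delta> C\<^sub>1 \<and> noncounitary_coideal K C \<Delta> C\<^sub>2 \<and>
       (\<forall>c\<^sub>1\<in>C\<^sub>1. \<forall>c\<^sub>2\<in>C\<^sub>2. P (c\<^sub>1 \<oplus>\<^bsub>C\<^esub> c\<^sub>2) = c\<^sub>1)"
    then obtain A B where dec: "direct_sum_decomposition K C A B"
      and coideals: "noncounitary_coideal K C \<Delta> A" "noncounitary_coideal K C \<Delta> B"
      and proj: "\<And>a b. a \<in> A \<Longrightarrow> b \<in> B \<Longrightarrow> P (a \<oplus>\<^bsub>C\<^esub> b) = a"
      by blast
    \<comment> \<open>Zero lies in both summands because their intersection is the zero
      space.\<close>
    have AB: "A \<subseteq> carrier C" "B \<subseteq> carrier C" "\<zero>\<^bsub>C\<^esub> \<in> A" "\<zero>\<^bsub>C\<^esub> \<in> B"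
        "A <+>\<^bsub>C\<^esub> B = carrier C"
      using dec C.submoduleE(1)[of A] C.submoduleE(1)[of B]
      unfolding direct_sum_decomposition_def by blast+
    \<comment> \<open>Setting the other component to zero in the projection formula gives the values
      of P on each summand.\<close>
    have PA: "P x = x" if "x \<in> A" for x using proj[OF that AB(4)] that AB(1) by auto
    have PB: "P x = \<zero>\<^bsub>C\<^esub>" if "x \<in> B" for x using proj[OF AB(3) that] that AB(2) by auto
    \<comment> \<open>P c is the component of c in \<open>A\<close>, where P is the
      identity.\<close>
    have "P (P c) = P c" if "c \<in> carrier C" for c
      using that PA proj unfolding AB(5)[symmetric] set_add_def' by auto
    then show "rota_baxter_operator K C \<Delta> (\<ominus>\<^bsub>K\<^esub> \<one>\<^bsub>K\<^esub>) P \<and> (\<forall>c\<in>carrier C. P (P c) = P c)"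
      using projection_rota_baxter_iff[OF linear dec PA PB] coideals by blast
  qed
qed

end
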